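(* Let $M$ be a smooth $n$-dimensional manifold, let $F(\tau)=F(\tau,x^i,y^a)$, $\tau\in[0,\tau_0)$, be a smooth family of fundamental Finsler functions on $\widetilde{TM}=TM\setminus\{0\}$ with nondegenerate Hessians ${}^{F}g_{ij}(\tau)={}^{F}h_{ij}(\tau)=\frac12\frac{\partial^2F^2(\tau)}{\partial y^i\partial y^j}$, and let ${}^{c}N_i^a(\tau)$ be the coefficients of its canonical N-connection. The Finsler–Ricci flows for $F(\tau)$ can be extracted from usual Ricci flows of metrics on $\widetilde{TM}$ parametrized, with respect to the local coordinate coframe $(dx^i,dy^a)$, in the form $$ {}^{F}g_{\underline{\alpha}\,\underline{\beta}}(\tau)=\begin{pmatrix} {}^{F}g_{ij}+{}^{c}N_i^a\,{}^{c}N_j^b\,{}^{F}g_{ab} & {}^{c}N_i^e\,{}^{F}g_{be}\\ {}^{c}N_j^e\,{}^{F}g_{ae} & {}^{F}g_{ab}\end{pmatrix} $$ and satisfying the (normalized) equations $$ \frac{\partial}{\partial\tau}\,{}^{F}g_{\underline{\alpha}\,\underline{\beta}}=-2\,{}^{F}R_{\underline{\alpha}\,\underline{\beta}}+\frac{2r}{5}\,{}^{F}g_{\underline{\alpha}\,\underline{\beta}},\qquad {}^{F}g_{\underline{\alpha}\,\underline{\beta}}\big|_{\tau=0}={}^{F}g^{[0]}_{\underline{\alpha}\,\underline{\beta}}(u), $$ where ${}^{F}R_{\underline{\alpha}\,\underline{\beta}}(\tau)$ is the Ricci tensor of the Levi-Civita connection of ${}^{F}g(\tau)$. Explicitly: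 if ${}^{F}g(\tau)$ satisfies these equations on $[0,\tau_0)$, then for every $\tau\in[0,\tau_0)$ the metric ${}^{F}g(\tau)$, with the prescribed $(n+n)$-splitting of coordinates, equivalently encodes the Finsler structure of $F(\tau)$ in N-adapted form: the N-connection determined by the blocks of ${}^{F}g(\tau)$ is the canonical N-connection ${}^{c}N(\tau)$; in the corresponding N-adapted coframe ${}^{F}g(\tau)$ is the Sasaki type d-metric ${}^{c}\mathbf{g}(\tau)$ of $F(\tau)$; and the canonical d-connection of Cartan type of $F(\tau)$ is determined by these data.
   Context: Local coordinates on $TM$ are $u=(x^i,y^a)$, with all indices running over $n$ values ($h$-indices $i,j,\dots$ and $v$-indices $a,b,\dots$ may be identified). A fundamental Finsler function $F(x,y)$ is a function smooth on $\widetilde{TM}$, continuous on the null section, with $F(x,\lambda y)=\lambda F(x,y)$ for nonzero $\lambda\in\mathbb{R}$. Canonical N-connection: with ${}^{F}h^{ab}$ the inverse of ${}^{F}h_{ab}$, $$G^a(\tau)=\tfrac14\,{}^{F}h^{ab}\Big(y^k\frac{\partial^2F^2}{\partial y^b\partial x^k}-\frac{\partial F^2}{\partial x^b}\Big),\qquad {}^{c}N_i^a(\tau)=\frac{\partial G^a(\tau)}{\partial y^i}.$$ An N-connection on a $2n$-manifold $V$ with the vertical subbundle $vV$ spanned by $\partial/\partial y^a$ is a splitting $TV=hV\oplus vV$; locally $hV$ is spanned by $\mathbf{e}_i=\partial/\partial x^i-N_i^a\,\partial/\partial y^a$. The N-adapted frame is $(\mathbf{e}_i,\ e_a=\partial/\partial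 y^a)$ with dual coframe $(e^i=dx^i,\ \mathbf{e}^a=dy^a+N_i^a dx^i)$. A metric with coordinate components $\underline g_{\alpha\beta}$ and nondegenerate vertical block $h_{ab}=\underline g_{ab}$ determines an N-connection by the condition $\underline g_{ia}-N_i^bh_{ab}=0$ (orthogonality of $hV$ and $vV$). A d-metric is a metric of the form $g_{ij}e^i\otimes e^j+h_{ab}\mathbf{e}^a\otimes\mathbf{e}^b$. A d-connection is a linear connection preserving the splitting $hV\oplus vV$ under parallel transport. The Sasaki type d-metric of $F(\tau)$ is ${}^{c}\mathbf{g}(\tau)={}^{F}h_{ij}(\tau)\big(e^i\otimes e^j+{}^{c}\mathbf{e}^i(\tau)\otimes{}^{c}\mathbf{e}^j(\tau)\big)$ with ${}^{c}\mathbf{e}^a(\tau)=dy^a+{}^{c}N_i^a(\tau)dx^i$. The canonical d-connection of Cartan type of $F(\tau)$ is the d-connection with N-adapted coefficients $(L^i_{jk},C^i_{jk})$ (the same for the action on $h$- and $v$-vectors), where, with ${}^{c}\mathbf{e}_k=\partial/\partial x^k-{}^{c}N_k^a\,\partial/\partial y^a$, $$L^i_{jk}=\tfrac12\,{}^{F}g^{ih}\big({}^{c}\mathbf{e}_k{}^{F}g_{jh}+{}^{c}\mathbf{e}_j{}^{F}g_{kh}-{}^{c}\mathbf{e}_h{}^{F}g_{jk}\big),\quad C^i_{jk}=\tfrac12\,{}^{F}g^{ih}\Big(\frac{\partial {}^{F}g_{jh}}{\partial y^k}+\frac{\partial {}^{F}g_{kh}}{\partial y^j}-\frac{\partial {}^{F}g_{jk}}{\partial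 y^h}\Big).$$ "Extracted from a Ricci flow" means that the structure, prescribing an $(n+n)$-splitting, can be redefined equivalently from the flowing metric as an N-adapted structure, subjected to the corresponding flow. The normalizing factor $r=r(\tau)$ is the average scalar curvature $\int R\,dV/\int dV$ of the metric (assumed well defined). *)

theory Defs
  imports "HOL-Analysis.Analysis"
begin

section \<open>Smooth maps between Euclidean spaces\<close>

fun cont_diff_on :: "nat \<Rightarrow> 'a::euclidean_space set \<Rightarrow> ('a \<Rightarrow> 'b::real_normed_vector) \<Rightarrow> bool" where
  "cont_diff_on 0 S f \<longleftrightarrow> continuous_on S f"
| "cont_diff_on (Suc k) S f \<longleftrightarrow> (\<forall>x\<in>S. f differentiable (at x)) \<and>
     (\<forall>v. cont_diff_on k S (\<lambda>x. frechet_derivative f (at x) v))"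

text \<open>\<^const>\<open>cont_diff_on\<close> is meaningful on open sets only. On an arbitrary set (needed for the
  half-open time interval) smoothness means local extendability to a smooth map.\<close>

definition smooth_on :: "'a::euclidean_space set \<Rightarrow> ('a \<Rightarrow> 'b::real_normed_vector) \<Rightarrow> bool" where
  "smooth_on S f \<longleftrightarrow> (\<forall>x\<in>S. \<exists>T h. open T \<and> x \<in> T \<and> (\<forall>k. cont_diff_on k T h) \<and>
     (\<forall>z\<in>S \<inter> T. h z = f z))"

definition partial :: "'k::finite \<Rightarrow> (real^'k \<Rightarrow> real) \<Rightarrow> real^'k \<Rightarrow> real" where
  "partial k f u = frechet_derivative f (at u) (axis k 1)"


section \<open>Smooth manifolds and their tangent bundles\<close>

type_synonym ('m, 'n) chart = "'m set \<times> ('m \<Rightarrow> real^'n)"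

definition chart_inv :: "('m, 'n) chart \<Rightarrow> real^'n \<Rightarrow> 'm" where
  "chart_inv c = inv_into (fst c) (snd c)"

definition transition :: "('m, 'n) chart \<Rightarrow> ('m, 'n) chart \<Rightarrow> real^'n \<Rightarrow> real^'n" where
  "transition c d = snd d \<circ> chart_inv c"

definition smooth_atlas ::
    "('m::{t2_space, second_countable_topology}, 'n::finite) chart set \<Rightarrow> bool" where
  "smooth_atlas A \<longleftrightarrow> (\<Union>c\<in>A. fst c) = UNIV \<and>
     (\<forall>c\<in>A. open (fst c) \<and> open (snd c ` fst c) \<and>
        homeomorphism (fst c) (snd c ` fst c) (snd c) (chart_inv c)) \<and>
     (\<forall>c\<in>A. \<forall>d\<in>A. smooth_on (snd c ` (fst c \<inter> fst d)) (transition c d))"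

text \<open>A tangent vector at \<open>p\<close> is the family of its component vectors in all charts around \<open>p\<close>, subject
  to the contravariant transformation law (and set to 0 at irrelevant indices, so that equality
  of families is equality of tangent vectors).\<close>

type_synonym ('m, 'n) tvec = "'m \<times> (('m, 'n) chart \<Rightarrow> real^'n)"

definition tangent_bundle :: "('m, 'n::finite) chart set \<Rightarrow> ('m, 'n) tvec set" where
  "tangent_bundle A = {(p, v).
     (\<forall>c\<in>A. \<forall>d\<in>A. p \<in> fst c \<longrightarrow> p \<in> fst d \<longrightarrow>
        v d = frechet_derivative (transition c d) (at (snd c p)) (v c)) \<and>
     (\<forall>c. c \<notin> A \<or> p \<notin> fst c \<longrightarrow> v c = 0)}"

definition slit_bundle :: "('m, 'n::finite) chart set \<Rightarrow> ('m, 'n) tvec set" where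
  "slit_bundle A = {w \<in> tangent_bundle A. snd w \<noteq> (\<lambda>_. 0)}"

definition fibre_scale :: "real \<Rightarrow> ('m, 'n::finite) tvec \<Rightarrow> ('m, 'n) tvec" where
  "fibre_scale l w = (fst w, \<lambda>c. l *\<^sub>R snd w c)"

text \<open>Coordinates \<open>u = (x, y)\<close> on the tangent bundle are vectors indexed by the disjoint union
  \<open>'n + 'n\<close>: \<open>Inl i\<close> is an h-index, \<open>Inr a\<close> a v-index.\<close>

definition xpart :: "real^('n + 'n) \<Rightarrow> real^'n" where
  "xpart u = (\<chi> i. u $ Inl i)"

definition ypart :: "real^('n + 'n) \<Rightarrow> real^'n" where
  "ypart u = (\<chi> a. u $ Inr a)"

definition tm_coords :: "('m, 'n::finite) chart \<Rightarrow> ('m, 'n) tvec \<Rightarrow> real^('n + 'n)" where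
  "tm_coords c w = (\<chi> \<alpha>. case \<alpha> of Inl i \<Rightarrow> snd c (fst w) $ i | Inr a \<Rightarrow> snd w c $ a)"

definition tm_point ::
    "('m, 'n::finite) chart set \<Rightarrow> ('m, 'n) chart \<Rightarrow> real^('n + 'n) \<Rightarrow> ('m, 'n) tvec" where
  "tm_point A c = inv_into {w \<in> tangent_bundle A. fst w \<in> fst c} (tm_coords c)"

text \<open>Images, under the induced charts, of the tangent bundle and of the slit tangent bundle.\<close>

definition tm_region :: "('m, 'n::finite) chart \<Rightarrow> (real^('n + 'n)) set" where
  "tm_region c = {u. xpart u \<in> snd c ` fst c}"

definition slit_region :: "('m, 'n::finite) chart \<Rightarrow> (real^('n + 'n)) set" where
  "slit_region c = {u \<in> tm_region c. ypart u \<noteq> 0}"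

definition local_rep :: "('m, 'n::finite) chart set \<Rightarrow> ('m, 'n) chart \<Rightarrow>
    (('m, 'n) tvec \<Rightarrow> real) \<Rightarrow> real^('n + 'n) \<Rightarrow> real" where
  "local_rep A c f u = f (tm_point A c u)"


section \<open>Metrics, Levi-Civita connection and Ricci tensor in coordinates\<close>

type_synonym 'k metric_field = "real^'k \<Rightarrow> real^'k^'k"

text \<open>Coefficients of a linear connection in a coordinate frame: \<open>\<Gamma> u \<gamma> \<beta> \<alpha>\<close> is the coefficient in
  \<open>\<nabla>\<^bsub>\<partial>\<^sub>\<alpha>\<^esub> \<partial>\<^sub>\<beta> = (\<Sum>\<gamma>. \<Gamma> u \<gamma> \<beta> \<alpha> \<partial>\<^sub>\<gamma>)\<close>.\<close>

type_synonym 'k connection = "real^'k \<Rightarrow> 'k \<Rightarrow> 'k \<Rightarrow> 'k \<Rightarrow> real"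

definition tensor_of :: "real^'k^'k \<Rightarrow> real^'k \<Rightarrow> real^'k \<Rightarrow> real" where
  "tensor_of H X Y = (\<Sum>\<alpha>\<in>UNIV. \<Sum>\<beta>\<in>UNIV. H $ \<alpha> $ \<beta> * X $ \<alpha> * Y $ \<beta>)"

definition levi_civita :: "'k::finite metric_field \<Rightarrow> 'k connection" where
  "levi_civita G u \<gamma> \<beta> \<alpha> = (1/2) * (\<Sum>\<delta>\<in>UNIV. matrix_inv (G u) $ \<gamma> $ \<delta> *
     (partial \<alpha> (\<lambda>w. G w $ \<beta> $ \<delta>) u + partial \<beta> (\<lambda>w. G w $ \<alpha> $ \<delta>) u
        - partial \<delta> (\<lambda>w. G w $ \<alpha> $ \<beta>) u))"

text \<open>\<^const>\<open>levi_civita\<close> is the unique torsion-free metric connection.\<close>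

lemma levi_civita_unique:
  fixes G :: "'k::finite metric_field"
  assumes "open U" "u \<in> U"
    and sym: "\<And>w. w \<in> U \<Longrightarrow> transpose (G w) = G w"
    and det: "det (G u) \<noteq> 0"
  shows "\<Gamma> u = levi_civita G u \<longleftrightarrow>
    (\<forall>\<alpha> \<beta> \<gamma>. \<Gamma> u \<gamma> \<beta> \<alpha> = \<Gamma> u \<gamma> \<alpha> \<beta>) \<and>
    (\<forall>\<alpha> \<beta> \<delta>. partial \<alpha> (\<lambda>w. G w $ \<beta> $ \<delta>) u =
       (\<Sum>\<gamma>\<in>UNIV. \<Gamma> u \<gamma> \<beta> \<alpha> * G u $ \<gamma> $ \<delta>) + (\<Sum>\<gamma>\<in>UNIV. \<Gamma> u \<gamma> \<delta> \<alpha> * G u $ \<beta> $ \<gamma>))"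
proof -
  have Gs: "G w $ \<beta> $ \<delta> = G w $ \<delta> $ \<beta>" if "w \<in> U" for w \<beta> \<delta>
    using arg_cong[OF sym[OF that], of "\<lambda>M. M $ \<beta> $ \<delta>"] by (simp add: transpose_def)
  define d where "d \<alpha> \<beta> \<delta> = partial \<alpha> (\<lambda>w. G w $ \<beta> $ \<delta>) u" for \<alpha> \<beta> \<delta>
  have ds: "d \<alpha> \<beta> \<delta> = d \<alpha> \<delta> \<beta>" for \<alpha> \<beta> \<delta>
  proof -
    have "((\<lambda>w. G w $ \<beta> $ \<delta>) has_derivative D) (at u) \<longleftrightarrow>
          ((\<lambda>w. G w $ \<delta> $ \<beta>) has_derivative D) (at u)" for D
      by (intro iffI; erule has_derivative_transform_within_open[OF _ assms(1,2)]; rule Gs)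
    then show ?thesis by (simp add: d_def partial_def frechet_derivative_def)
  qed
  define low where "low \<delta> \<beta> \<alpha> = (\<Sum>\<gamma>\<in>UNIV. G u $ \<delta> $ \<gamma> * \<Gamma> u \<gamma> \<beta> \<alpha>)" for \<delta> \<beta> \<alpha>
  define K where "K \<delta> \<beta> \<alpha> = (1/2) * (d \<alpha> \<beta> \<delta> + d \<beta> \<alpha> \<delta> - d \<delta> \<alpha> \<beta>)" for \<delta> \<beta> \<alpha>
  have inv: "invertible (G u)" using det by (simp add: invertible_det_nz)
  have inv: "matrix_inv (G u) ** G u = mat 1" "G u ** matrix_inv (G u) = mat 1"
    using someI_ex[OF inv[unfolded invertible_def]] by (simp_all add: matrix_inv_def)
  have mv: "(G u *v x = y) \<longleftrightarrow> (x = matrix_inv (G u) *v y)" for x y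
    using inv by (metis matrix_vector_mul_assoc matrix_vector_mul_lid)
  have LC: "levi_civita G u \<gamma> \<beta> \<alpha> = (matrix_inv (G u) *v (\<chi> \<delta>. K \<delta> \<beta> \<alpha>)) $ \<gamma>" for \<gamma> \<beta> \<alpha>
    by (simp add: levi_civita_def matrix_vector_mult_def K_def d_def sum_distrib_left algebra_simps)
  have "\<Gamma> u = levi_civita G u \<longleftrightarrow>
      (\<forall>\<beta> \<alpha>. (\<chi> \<gamma>. \<Gamma> u \<gamma> \<beta> \<alpha>) = matrix_inv (G u) *v (\<chi> \<delta>. K \<delta> \<beta> \<alpha>))"
    unfolding fun_eq_iff vec_eq_iff LC by auto
  also have "\<dots> \<longleftrightarrow> (\<forall>\<beta> \<alpha> \<delta>. low \<delta> \<beta> \<alpha> = K \<delta> \<beta> \<alpha>)"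
    unfolding mv[symmetric] by (simp add: vec_eq_iff matrix_vector_mult_def low_def)
  also have "\<dots> \<longleftrightarrow> (\<forall>\<alpha> \<beta> \<delta>. low \<delta> \<beta> \<alpha> = low \<delta> \<alpha> \<beta>) \<and>
      (\<forall>\<alpha> \<beta> \<delta>. d \<alpha> \<beta> \<delta> = low \<delta> \<beta> \<alpha> + low \<beta> \<delta> \<alpha>)"
    (is "?P \<longleftrightarrow> ?Q1 \<and> ?Q2")
  proof
    assume P: ?P
    have ?Q1 unfolding P[rule_format] K_def using ds by (simp add: algebra_simps)
    moreover have ?Q2
    proof (intro allI)
      fix \<alpha> \<beta> \<delta>
      show "d \<alpha> \<beta> \<delta> = low \<delta> \<beta> \<alpha> + low \<beta> \<delta> \<alpha>"
        unfolding P[rule_format] K_def using ds[of \<alpha> \<beta> \<delta>] ds[of \<beta> \<alpha> \<delta>] ds[of \<delta> \<alpha> \<beta>] by argo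
    qed
    ultimately show "?Q1 \<and> ?Q2" by blast
  next
    assume Q: "?Q1 \<and> ?Q2"
    show ?P
    proof (intro allI)
      fix \<beta> \<alpha> \<delta>
      have c: "d \<alpha> \<beta> \<delta> = low \<delta> \<beta> \<alpha> + low \<beta> \<delta> \<alpha>"
          "d \<beta> \<alpha> \<delta> = low \<delta> \<alpha> \<beta> + low \<alpha> \<delta> \<beta>"
          "d \<delta> \<alpha> \<beta> = low \<beta> \<alpha> \<delta> + low \<alpha> \<beta> \<delta>" using Q by blast+
      have t: "low \<delta> \<alpha> \<beta> = low \<delta> \<beta> \<alpha>" "low \<beta> \<alpha> \<delta> = low \<beta> \<delta> \<alpha>" "low \<alpha> \<beta> \<delta> = low \<alpha> \<delta> \<beta>"
        using Q by blast+
      show "low \<delta> \<beta> \<alpha> = K \<delta> \<beta> \<alpha>" unfolding K_def c t by simp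
    qed
  qed
  also have "?Q1 \<longleftrightarrow> (\<forall>\<alpha> \<beta> \<gamma>. \<Gamma> u \<gamma> \<beta> \<alpha> = \<Gamma> u \<gamma> \<alpha> \<beta>)"
  proof
    assume Q1: ?Q1
    have "(\<chi> \<gamma>. \<Gamma> u \<gamma> \<beta> \<alpha>) = (\<chi> \<gamma>. \<Gamma> u \<gamma> \<alpha> \<beta>)" for \<alpha> \<beta>
    proof -
      have "G u *v (\<chi> \<gamma>. \<Gamma> u \<gamma> \<beta> \<alpha>) = G u *v (\<chi> \<gamma>. \<Gamma> u \<gamma> \<alpha> \<beta>)"
        using Q1 by (simp add: vec_eq_iff matrix_vector_mult_def low_def)
      then show ?thesis using mv by metis
    qed
    then show "\<forall>\<alpha> \<beta> \<gamma>. \<Gamma> u \<gamma> \<beta> \<alpha> = \<Gamma> u \<gamma> \<alpha> \<beta>" by (simp add: vec_eq_iff)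
  qed (simp add: low_def)
  finally show ?thesis
    unfolding low_def d_def using Gs[OF assms(2)] by (simp add: mult.commute)
qed

text \<open>\<open>riemann \<Gamma> u \<delta> \<gamma> \<alpha> \<beta>\<close> is the \<open>\<delta>\<close>-component of \<open>R(\<partial>\<^sub>\<alpha>, \<partial>\<^sub>\<beta>) \<partial>\<^sub>\<gamma>\<close>; with this sign convention round spheres
  have positive Ricci tensor.\<close>

definition riemann :: "'k::finite connection \<Rightarrow> real^'k \<Rightarrow> 'k \<Rightarrow> 'k \<Rightarrow> 'k \<Rightarrow> 'k \<Rightarrow> real" where
  "riemann \<Gamma> u \<delta> \<gamma> \<alpha> \<beta> =
     partial \<alpha> (\<lambda>w. \<Gamma> w \<delta> \<gamma> \<beta>) u - partial \<beta> (\<lambda>w. \<Gamma> w \<delta> \<gamma> \<alpha>) u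
     + (\<Sum>\<epsilon>\<in>UNIV. \<Gamma> u \<delta> \<epsilon> \<alpha> * \<Gamma> u \<epsilon> \<gamma> \<beta> - \<Gamma> u \<delta> \<epsilon> \<beta> * \<Gamma> u \<epsilon> \<gamma> \<alpha>)"

definition ricci :: "'k::finite metric_field \<Rightarrow> real^'k \<Rightarrow> 'k \<Rightarrow> 'k \<Rightarrow> real" where
  "ricci G u \<gamma> \<beta> = (\<Sum>\<alpha>\<in>UNIV. riemann (levi_civita G) u \<alpha> \<gamma> \<alpha> \<beta>)"

definition scalar_curvature :: "'k::finite metric_field \<Rightarrow> real^'k \<Rightarrow> real" where
  "scalar_curvature G u =
     (\<Sum>\<gamma>\<in>UNIV. \<Sum>\<beta>\<in>UNIV. matrix_inv (G u) $ \<gamma> $ \<beta> * ricci G u \<gamma> \<beta>)"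


section \<open>Ricci flows on the slit tangent bundle\<close>

text \<open>A metric on the slit tangent bundle is given by its component matrices in all induced charts,
  subject to the covariant transformation law. The signature is not prescribed.\<close>

type_synonym ('m, 'n) tm_metric = "('m, 'n) chart \<Rightarrow> ('n + 'n) metric_field"

definition metric_on_slit_bundle ::
    "('m, 'n::finite) chart set \<Rightarrow> ('m, 'n) tm_metric \<Rightarrow> bool" where
  "metric_on_slit_bundle A G \<longleftrightarrow>
     (\<forall>c\<in>A. smooth_on (slit_region c) (G c) \<and>
        (\<forall>u\<in>slit_region c. transpose (G c u) = G c u \<and> det (G c u) \<noteq> 0)) \<and>
     (\<forall>c\<in>A. \<forall>d\<in>A. \<forall>u\<in>slit_region c. fst (tm_point A c u) \<in> fst d \<longrightarrow>
        (let \<Phi> = tm_coords d \<circ> tm_point A c; J = matrix (frechet_derivative \<Phi> (at u))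
         in G c u = transpose J ** G d (\<Phi> u) ** J))"

definition volume_measure ::
    "('m, 'n::finite) chart set \<Rightarrow> ('m, 'n) tm_metric \<Rightarrow> ('m, 'n) tvec measure \<Rightarrow> bool" where
  "volume_measure A G \<mu> \<longleftrightarrow> space \<mu> = slit_bundle A \<and>
     sets \<mu> = sigma_sets (slit_bundle A)
       {{w \<in> slit_bundle A. fst w \<in> fst c \<and> tm_coords c w \<in> B} | c B. c \<in> A \<and> B \<in> sets borel} \<and>
     (\<forall>c\<in>A. \<forall>B\<in>sets borel.
        emeasure \<mu> {w \<in> slit_bundle A. fst w \<in> fst c \<and> tm_coords c w \<in> B} =
        (\<integral>\<^sup>+u. ennreal (sqrt \<bar>det (G c u)\<bar>) * indicator (B \<inter> slit_region c) u \<partial>lborel))"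

text \<open>\<open>r\<close> is the average scalar curvature \<open>\<integral>R dV / \<integral>dV\<close>, well defined in the sense that \<open>R\<close> is integrable.
  If the total volume is infinite, the quotient is 0, in accordance with the library conventions
  for \<^const>\<open>measure\<close> and division.\<close>

definition average_scalar_curvature ::
    "('m, 'n::finite) chart set \<Rightarrow> ('m, 'n) tm_metric \<Rightarrow> real \<Rightarrow> bool" where
  "average_scalar_curvature A G r \<longleftrightarrow> (\<exists>\<mu> R. volume_measure A G \<mu> \<and>
     (\<forall>c\<in>A. \<forall>w\<in>slit_bundle A. fst w \<in> fst c \<longrightarrow> R w = scalar_curvature (G c) (tm_coords c w)) \<and>
     integrable \<mu> R \<and> r = (LINT w|\<mu>. R w) / measure \<mu> (space \<mu>))"

definition normalized_ricci_flow :: "('m, 'n::finite) chart set \<Rightarrow> real \<Rightarrow>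
    (real \<Rightarrow> ('m, 'n) tm_metric) \<Rightarrow> ('m, 'n) tm_metric \<Rightarrow> (real \<Rightarrow> real) \<Rightarrow> bool" where
  "normalized_ricci_flow A \<tau>\<^sub>0 g g0 r \<longleftrightarrow>
     (\<forall>\<tau>\<in>{0..<\<tau>\<^sub>0}. metric_on_slit_bundle A (g \<tau>) \<and> average_scalar_curvature A (g \<tau>) (r \<tau>)) \<and>
     (\<forall>c\<in>A. smooth_on ({0..<\<tau>\<^sub>0} \<times> slit_region c) (\<lambda>(\<tau>, u). g \<tau> c u)) \<and>
     (\<forall>\<tau>\<in>{0..<\<tau>\<^sub>0}. \<forall>c\<in>A. \<forall>u\<in>slit_region c. \<forall>\<alpha> \<beta>.
        ((\<lambda>s. g s c u $ \<alpha> $ \<beta>) has_real_derivative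
           - 2 * ricci (g \<tau> c) u \<alpha> \<beta> + (2 * r \<tau> / 5) * g \<tau> c u $ \<alpha> $ \<beta>)
          (at \<tau> within {0..<\<tau>\<^sub>0})) \<and>
     (\<forall>c\<in>A. \<forall>u\<in>slit_region c. g 0 c u = g0 c u)"


section \<open>N-connections, d-metrics and d-connections\<close>

text \<open>\<open>N $ i $ a\<close> is the N-connection coefficient with h-index \<open>i\<close> and v-index \<open>a\<close>.\<close>

definition h_frame :: "real^'n^'n \<Rightarrow> 'n::finite \<Rightarrow> real^('n + 'n)" where
  "h_frame N i = axis (Inl i) 1 - (\<Sum>a\<in>UNIV. N $ i $ a *\<^sub>R axis (Inr a) 1)"

definition v_frame :: "'n::finite \<Rightarrow> real^('n + 'n)" where
  "v_frame a = axis (Inr a) 1"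

definition h_coframe :: "'n::finite \<Rightarrow> real^('n + 'n) \<Rightarrow> real" where
  "h_coframe i X = X $ Inl i"

definition v_coframe :: "real^'n^'n \<Rightarrow> 'n::finite \<Rightarrow> real^('n + 'n) \<Rightarrow> real" where
  "v_coframe N a X = X $ Inr a + (\<Sum>i\<in>UNIV. N $ i $ a * X $ Inl i)"

definition h_space :: "real^'n^'n \<Rightarrow> (real^('n::finite + 'n)) set" where
  "h_space N = span (range (h_frame N))"

definition v_space :: "(real^('n::finite + 'n)) set" where
  "v_space = span (range v_frame)"

definition dmetric :: "real^'n^'n \<Rightarrow> real^'n^'n \<Rightarrow> real^'n^'n \<Rightarrow>
    real^('n::finite + 'n) \<Rightarrow> real^('n + 'n) \<Rightarrow> real" where
  "dmetric N g h X Y =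
     (\<Sum>i\<in>UNIV. \<Sum>j\<in>UNIV. g $ i $ j * h_coframe i X * h_coframe j Y) +
     (\<Sum>a\<in>UNIV. \<Sum>b\<in>UNIV. h $ a $ b * v_coframe N a X * v_coframe N b Y)"

definition v_block :: "real^('n + 'n)^('n + 'n) \<Rightarrow> real^'n^'n" where
  "v_block H = (\<chi> a b. H $ Inr a $ Inr b)"

definition determines_nconnection ::
    "real^('n::finite + 'n)^('n + 'n) \<Rightarrow> real^'n^'n \<Rightarrow> bool" where
  "determines_nconnection H N \<longleftrightarrow> det (v_block H) \<noteq> 0 \<and>
     (\<forall>i a. H $ Inl i $ Inr a - (\<Sum>b\<in>UNIV. N $ i $ b * v_block H $ b $ a) = 0)"

definition nconnection_of :: "real^('n::finite + 'n)^('n + 'n) \<Rightarrow> real^'n^'n" where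
  "nconnection_of H = (THE N. determines_nconnection H N)"

text \<open>The h-components of \<open>H\<close> in the frame adapted to the N-connection that \<open>H\<close> determines.\<close>

definition h_block :: "real^('n::finite + 'n)^('n + 'n) \<Rightarrow> real^'n^'n" where
  "h_block H = (\<chi> i j. tensor_of H (h_frame (nconnection_of H) i) (h_frame (nconnection_of H) j))"

text \<open>The derivative of \<open>f\<close> along the k-th horizontal frame field.\<close>

definition h_partial :: "(real^('n::finite + 'n) \<Rightarrow> real^'n^'n) \<Rightarrow> 'n \<Rightarrow>
    (real^('n + 'n) \<Rightarrow> real) \<Rightarrow> real^('n + 'n) \<Rightarrow> real" where
  "h_partial N k f u = partial (Inl k) f u - (\<Sum>a\<in>UNIV. N u $ k $ a * partial (Inr a) f u)"

definition L_coeff :: "(real^('n::finite + 'n) \<Rightarrow> real^'n^'n) \<Rightarrow> (real^('n + 'n) \<Rightarrow> real^'n^'n) \<Rightarrow>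
    real^('n + 'n) \<Rightarrow> 'n \<Rightarrow> 'n \<Rightarrow> 'n \<Rightarrow> real" where
  "L_coeff N g u i j k = (1/2) * (\<Sum>h\<in>UNIV. matrix_inv (g u) $ i $ h *
     (h_partial N k (\<lambda>w. g w $ j $ h) u + h_partial N j (\<lambda>w. g w $ k $ h) u
        - h_partial N h (\<lambda>w. g w $ j $ k) u))"

definition C_coeff :: "(real^('n::finite + 'n) \<Rightarrow> real^'n^'n) \<Rightarrow>
    real^('n + 'n) \<Rightarrow> 'n \<Rightarrow> 'n \<Rightarrow> 'n \<Rightarrow> real" where
  "C_coeff g u i j k = (1/2) * (\<Sum>h\<in>UNIV. matrix_inv (g u) $ i $ h *
     (partial (Inr k) (\<lambda>w. g w $ j $ h) u + partial (Inr j) (\<lambda>w. g w $ k $ h) u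
        - partial (Inr h) (\<lambda>w. g w $ j $ k) u))"

definition connection_term :: "'k::finite connection \<Rightarrow> real^'k \<Rightarrow> real^'k \<Rightarrow> real^'k \<Rightarrow> real^'k" where
  "connection_term \<Gamma> u X Y = (\<chi> \<gamma>. \<Sum>\<beta>\<in>UNIV. \<Sum>\<alpha>\<in>UNIV. \<Gamma> u \<gamma> \<beta> \<alpha> * Y $ \<beta> * X $ \<alpha>)"

definition covariant_derivative :: "'k::finite connection \<Rightarrow>
    (real^'k \<Rightarrow> real^'k) \<Rightarrow> (real^'k \<Rightarrow> real^'k) \<Rightarrow> real^'k \<Rightarrow> real^'k" where
  "covariant_derivative \<Gamma> X Y u =
     frechet_derivative Y (at u) (X u) + connection_term \<Gamma> u (X u) (Y u)"

definition parallel_along :: "'k::finite connection \<Rightarrow>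
    (real \<Rightarrow> real^'k) \<Rightarrow> (real \<Rightarrow> real^'k) \<Rightarrow> (real \<Rightarrow> real^'k) \<Rightarrow> bool" where
  "parallel_along \<Gamma> \<gamma> \<gamma>' V \<longleftrightarrow> (\<forall>t\<in>{0..1}.
     (V has_vector_derivative - connection_term \<Gamma> (\<gamma> t) (\<gamma>' t) (V t)) (at t within {0..1}))"

definition d_connection :: "(real^('n::finite + 'n)) set \<Rightarrow>
    (real^('n + 'n) \<Rightarrow> real^'n^'n) \<Rightarrow> ('n + 'n) connection \<Rightarrow> bool" where
  "d_connection U N \<Gamma> \<longleftrightarrow> (\<forall>\<gamma> \<beta> \<alpha>. smooth_on U (\<lambda>u. \<Gamma> u \<gamma> \<beta> \<alpha>)) \<and>
     (\<forall>\<gamma> \<gamma>' V. \<gamma> ` {0..1} \<subseteq> U \<and> continuous_on {0..1} \<gamma>' \<and>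
        (\<forall>t\<in>{0..1}. (\<gamma> has_vector_derivative \<gamma>' t) (at t within {0..1})) \<and>
        parallel_along \<Gamma> \<gamma> \<gamma>' V \<longrightarrow>
        (V 0 \<in> h_space (N (\<gamma> 0)) \<longrightarrow> V 1 \<in> h_space (N (\<gamma> 1))) \<and>
        (V 0 \<in> v_space \<longrightarrow> V 1 \<in> v_space))"

text \<open>The coefficients \<open>(L, C)\<close> act in the same way on h- and v-vectors (h- and v-indices are
  identified); \<open>L i j k\<close> and \<open>C i j k\<close> have upper index \<open>i\<close>, and \<open>k\<close> is the direction of
  differentiation.\<close>

definition has_adapted_coeffs :: "(real^('n::finite + 'n)) set \<Rightarrow>
    (real^('n + 'n) \<Rightarrow> real^'n^'n) \<Rightarrow>
    (real^('n + 'n) \<Rightarrow> 'n \<Rightarrow> 'n \<Rightarrow> 'n \<Rightarrow> real) \<Rightarrow> (real^('n + 'n) \<Rightarrow> 'n \<Rightarrow> 'n \<Rightarrow> 'n \<Rightarrow> real) \<Rightarrow>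
    ('n + 'n) connection \<Rightarrow> bool" where
  "has_adapted_coeffs U N L C \<Gamma> \<longleftrightarrow> (\<forall>u\<in>U. \<forall>j k.
     covariant_derivative \<Gamma> (\<lambda>w. h_frame (N w) k) (\<lambda>w. h_frame (N w) j) u
       = (\<Sum>i\<in>UNIV. L u i j k *\<^sub>R h_frame (N u) i) \<and>
     covariant_derivative \<Gamma> (\<lambda>w. h_frame (N w) k) (\<lambda>w. v_frame j) u
       = (\<Sum>i\<in>UNIV. L u i j k *\<^sub>R v_frame i) \<and>
     covariant_derivative \<Gamma> (\<lambda>w. v_frame k) (\<lambda>w. h_frame (N w) j) u
       = (\<Sum>i\<in>UNIV. C u i j k *\<^sub>R h_frame (N u) i) \<and>
     covariant_derivative \<Gamma> (\<lambda>w. v_frame k) (\<lambda>w. v_frame j) u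
       = (\<Sum>i\<in>UNIV. C u i j k *\<^sub>R v_frame i))"

text \<open>The canonical d-connection of Cartan type built from an N-connection \<open>N\<close>, an h-metric \<open>g\<close> and a
  v-metric \<open>h\<close>.\<close>

definition cartan_dconnection :: "(real^('n::finite + 'n)) set \<Rightarrow>
    (real^('n + 'n) \<Rightarrow> real^'n^'n) \<Rightarrow> (real^('n + 'n) \<Rightarrow> real^'n^'n) \<Rightarrow>
    (real^('n + 'n) \<Rightarrow> real^'n^'n) \<Rightarrow> ('n + 'n) connection \<Rightarrow> bool" where
  "cartan_dconnection U N g h \<Gamma> \<longleftrightarrow>
     d_connection U N \<Gamma> \<and> has_adapted_coeffs U N (L_coeff N g) (C_coeff h) \<Gamma>"

text \<open>The same, built only from (the coordinate components of) a metric with nondegenerate v-block.\<close>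

definition cartan_dconnection_of_metric ::
    "(real^('n::finite + 'n)) set \<Rightarrow> ('n + 'n) metric_field \<Rightarrow> ('n + 'n) connection \<Rightarrow> bool" where
  "cartan_dconnection_of_metric U G =
     cartan_dconnection U (nconnection_of \<circ> G) (h_block \<circ> G) (v_block \<circ> G)"


section \<open>Finsler functions\<close>

definition finsler_hessian :: "(real^('n::finite + 'n) \<Rightarrow> real) \<Rightarrow> real^('n + 'n) \<Rightarrow> real^'n^'n" where
  "finsler_hessian F u = (\<chi> i j. (1/2) * partial (Inr i) (partial (Inr j) (\<lambda>w. (F w)\<^sup>2)) u)"

text \<open>Homogeneity is required for positive factors only. Demanding \<open>F (l * y) = l * F y\<close> also for
  negative \<open>l\<close> would make \<open>F\<close> odd on the fibres; for \<open>n \<ge> 2\<close> it would then vanish at some \<open>y \<noteq> 0\<close>, where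
  the Hessian of \<open>F\<^sup>2\<close> has rank at most 1 and so is degenerate.\<close>

definition finsler_family ::
    "('m, 'n::finite) chart set \<Rightarrow> real \<Rightarrow> (real \<Rightarrow> ('m, 'n) tvec \<Rightarrow> real) \<Rightarrow> bool" where
  "finsler_family A \<tau>\<^sub>0 F \<longleftrightarrow>
     (\<forall>c\<in>A. smooth_on ({0..<\<tau>\<^sub>0} \<times> slit_region c) (\<lambda>(\<tau>, u). local_rep A c (F \<tau>) u)) \<and>
     (\<forall>\<tau>\<in>{0..<\<tau>\<^sub>0}.
        (\<forall>c\<in>A. continuous_on (tm_region c) (local_rep A c (F \<tau>))) \<and>
        (\<forall>w\<in>tangent_bundle A. \<forall>l>0. F \<tau> (fibre_scale l w) = l * F \<tau> w) \<and>
        (\<forall>c\<in>A. \<forall>u\<in>slit_region c. det (finsler_hessian (local_rep A c (F \<tau>)) u) \<noteq> 0))"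

definition spray_coeff :: "(real^('n::finite + 'n) \<Rightarrow> real) \<Rightarrow> 'n \<Rightarrow> real^('n + 'n) \<Rightarrow> real" where
  "spray_coeff F a u = (1/4) * (\<Sum>b\<in>UNIV. matrix_inv (finsler_hessian F u) $ a $ b *
     ((\<Sum>k\<in>UNIV. u $ Inr k * partial (Inr b) (partial (Inl k) (\<lambda>w. (F w)\<^sup>2)) u)
        - partial (Inl b) (\<lambda>w. (F w)\<^sup>2) u))"

definition canonical_nconnection ::
    "(real^('n::finite + 'n) \<Rightarrow> real) \<Rightarrow> real^('n + 'n) \<Rightarrow> real^'n^'n" where
  "canonical_nconnection F u = (\<chi> i a. partial (Inr i) (spray_coeff F a) u)"

definition sasaki_dmetric :: "(real^('n::finite + 'n) \<Rightarrow> real) \<Rightarrow> real^('n + 'n) \<Rightarrow>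
    real^('n + 'n) \<Rightarrow> real^('n + 'n) \<Rightarrow> real" where
  "sasaki_dmetric F u =
     dmetric (canonical_nconnection F u) (finsler_hessian F u) (finsler_hessian F u)"

definition canonical_dconnection :: "(real^('n::finite + 'n)) set \<Rightarrow>
    (real^('n + 'n) \<Rightarrow> real) \<Rightarrow> ('n + 'n) connection \<Rightarrow> bool" where
  "canonical_dconnection U F =
     cartan_dconnection U (canonical_nconnection F) (finsler_hessian F) (finsler_hessian F)"

definition finsler_metric_matrix :: "(real^('n::finite + 'n) \<Rightarrow> real) \<Rightarrow> ('n + 'n) metric_field" where
  "finsler_metric_matrix F u =
     (let g = finsler_hessian F u; N = canonical_nconnection F u in
      \<chi> \<alpha> \<beta>. case \<alpha> of
          Inl i \<Rightarrow> (case \<beta> of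
              Inl j \<Rightarrow> g $ i $ j + (\<Sum>a\<in>UNIV. \<Sum>b\<in>UNIV. N $ i $ a * N $ j $ b * g $ a $ b)
            | Inr b \<Rightarrow> (\<Sum>e\<in>UNIV. N $ i $ e * g $ b $ e))
        | Inr a \<Rightarrow> (case \<beta> of
              Inl j \<Rightarrow> (\<Sum>e\<in>UNIV. N $ j $ e * g $ a $ e)
            | Inr b \<Rightarrow> g $ a $ b))"

end

theory Submission
  imports Defs
begin

text \<open>
  Fix a time \<open>\<tau>\<close> and a chart, let \<open>U\<close> be the (open) image of the slit tangent bundle, \<open>F\<close> the Finsler
  function in these coordinates, \<open>h\<close> its Hessian, \<open>N\<close> its canonical N-connection and \<open>G\<close> the flowing
  metric. All claims concern this one time slice; the flow enters through the regularity of its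
  slices: \<open>G\<close> is a smooth symmetric matrix field on \<open>U\<close>.

  The v-block of \<open>G\<close> is \<open>h\<close>, so \<open>h\<close> is smooth and symmetric. The mixed block is \<open>N h\<close>, and \<open>h\<close> is
  invertible; hence \<open>N\<close> is the only solution of the orthogonality condition between the horizontal and
  the vertical space, and \<open>N = (N h) h\<^sup>-\<^sup>1\<close> is smooth because matrix inversion is (Cramer's rule).
  Collecting the terms of \<open>G(X, Y)\<close> into the coframe \<open>dx\<^sup>i\<close>, \<open>dy\<^sup>a + N\<^sub>i\<^sup>a dx\<^sup>i\<close> completes the square
  and leaves the Sasaki type d-metric. This is \<open>tensor_of_finsler_metric_matrix\<close> and
  \<open>determines_nconnection_finsler_metric_matrix\<close>; in particular the data \<open>(N, h, h)\<close> can be read off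
  from \<open>G\<close>.

  For the connection, prescribing the adapted coefficients \<open>(L, C)\<close> prescribes the covariant
  derivatives of all frame fields along all frame fields. The frame fields form a basis at every
  point and a connection is determined by a bilinear map, so exactly one connection on \<open>U\<close> has these
  coefficients, and it can be written down (\<open>adapted_coeffs_at_iff\<close>). It does preserve the splitting:
  along a curve the h-components, respectively the v-components, of a parallel field solve the
  homogeneous linear equation \<open>W' = - \<omega>(\<gamma>') W\<close> given by the connection forms \<open>\<omega>\<close>, and by Gronwall's
  argument a solution that starts at 0 stays 0 (\<open>linear_ode_zero\<close>, \<open>d_connection_adapted\<close>).
  Building this connection from \<open>F\<close> or from the blocks of \<open>G\<close> gives the same result, since the data
  coincide on the open set \<open>U\<close> and hence so do their derivatives.
\<close>

section \<open>Calculus of smooth functions on open sets\<close>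

lemma cont_diff_on_cong:
  assumes "open S" "\<And>x. x \<in> S \<Longrightarrow> f x = g x" "cont_diff_on k S f"
  shows "cont_diff_on k S g"
  using assms(2,3)
proof (induction k arbitrary: f g)
  case 0
  then show ?case by (simp cong: continuous_on_cong)
next
  case (Suc k)
  have D: "(g has_derivative frechet_derivative f (at x)) (at x)" if "x \<in> S" for x
    using Suc.prems that assms(1)
    by (auto intro: has_derivative_transform_within_open simp: frechet_derivative_works)
  then have E: "frechet_derivative g (at x) = frechet_derivative f (at x)" if "x \<in> S" for x
    using frechet_derivative_at that by metis
  have "cont_diff_on k S (\<lambda>x. frechet_derivative g (at x) v)" for v
    by (rule Suc.IH[of "\<lambda>x. frechet_derivative f (at x) v"]) (use E Suc.prems in auto)
  then show ?case using D by (auto simp: differentiable_def)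
qed

lemma cont_diff_on_subset: "cont_diff_on k S f \<Longrightarrow> T \<subseteq> S \<Longrightarrow> cont_diff_on k T f"
  by (induction k arbitrary: f) (auto intro: continuous_on_subset)

lemma cont_diff_on_Suc_imp: "cont_diff_on (Suc k) S f \<Longrightarrow> cont_diff_on k S f"
proof (induction k arbitrary: f)
  case 0
  then show ?case
    by (auto intro!: continuous_at_imp_continuous_on differentiable_imp_continuous_within)
next
  case (Suc k)
  have "cont_diff_on k S (\<lambda>x. frechet_derivative f (at x) v)" for v
    using iffD1[OF cont_diff_on.simps(2) Suc.prems] by (blast intro: Suc.IH)
  then show ?case
    using iffD1[OF cont_diff_on.simps(2) Suc.prems] by (blast intro: iffD2[OF cont_diff_on.simps(2)])
qed

text \<open>Being \<open>k\<close> times continuously differentiable is a local property. This turns the local smooth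
  extensions in \<^const>\<open>smooth_on\<close> into a statement about the function itself on an open set.\<close>

lemma cont_diff_on_local:
  assumes "\<And>x. x \<in> S \<Longrightarrow> \<exists>T. open T \<and> x \<in> T \<and> cont_diff_on k T f"
  shows "cont_diff_on k S f"
  using assms
proof (induction k arbitrary: f)
  case 0
  have "isCont f x" if "x \<in> S" for x
    using 0[OF that] by (auto simp: continuous_on_eq_continuous_at)
  then show ?case by (simp add: continuous_at_imp_continuous_on)
next
  case (Suc k)
  show ?case
    unfolding cont_diff_on.simps
  proof (intro conjI ballI allI)
    show "f differentiable (at x)" if "x \<in> S" for x
      using Suc.prems[OF that] by (elim exE conjE) simp
    show "cont_diff_on k S (\<lambda>x. frechet_derivative f (at x) v)" for v
    proof (rule Suc.IH)
      fix x assume "x \<in> S"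
      then obtain T where "open T" "x \<in> T" "cont_diff_on (Suc k) T f"
        using Suc.prems by blast
      then show "\<exists>T. open T \<and> x \<in> T \<and> cont_diff_on k T (\<lambda>x. frechet_derivative f (at x) v)"
        by (intro exI[of _ T]) simp
    qed
  qed
qed

lemma smooth_on_open_iff:
  assumes "open S"
  shows "smooth_on S f \<longleftrightarrow> (\<forall>k. cont_diff_on k S f)"
proof
  assume sm: "smooth_on S f"
  show "\<forall>k. cont_diff_on k S f"
  proof (intro allI cont_diff_on_local)
    fix k x assume "x \<in> S"
    from bspec[OF sm[unfolded smooth_on_def] this] obtain T h where T: "open T" "x \<in> T" "\<forall>k. cont_diff_on k T h"
      "\<forall>z\<in>S \<inter> T. h z = f z"
      by (elim exE conjE) (rule that)
    have "cont_diff_on k (S \<inter> T) f"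
      by (rule cont_diff_on_cong[of _ h]) (use T assms in \<open>simp_all add: open_Int cont_diff_on_subset[OF spec[OF T(3)]]\<close>)
    then show "\<exists>T. open T \<and> x \<in> T \<and> cont_diff_on k T f"
      using T(1,2) assms \<open>x \<in> S\<close> by (intro exI[of _ "S \<inter> T"]) (simp add: open_Int)
  qed
next
  assume "\<forall>k. cont_diff_on k S f"
  then show "smooth_on S f"
    unfolding smooth_on_def using assms by (intro ballI exI[of _ S] exI[of _ f]) simp
qed

lemma smooth_on_cong:
  assumes "smooth_on S f" "\<And>x. x \<in> S \<Longrightarrow> f x = g x"
  shows "smooth_on S g"
proof -
  have "(\<forall>z\<in>S \<inter> T. h z = f z) \<longleftrightarrow> (\<forall>z\<in>S \<inter> T. h z = g z)" for T h
    using assms(2) by auto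
  then show ?thesis using assms(1) unfolding smooth_on_def by simp
qed

lemma smooth_on_imp_continuous_on: "open S \<Longrightarrow> smooth_on S f \<Longrightarrow> continuous_on S f"
  by (simp only: smooth_on_open_iff cont_diff_on.simps(1)[symmetric])

lemma smooth_on_imp_differentiable:
  "open S \<Longrightarrow> smooth_on S f \<Longrightarrow> x \<in> S \<Longrightarrow> f differentiable (at x)"
  by (simp only: smooth_on_open_iff) (drule spec[of _ "Suc 0"], simp)

lemma smooth_on_frechet_derivative:
  "open S \<Longrightarrow> smooth_on S f \<Longrightarrow> smooth_on S (\<lambda>x. frechet_derivative f (at x) v)"
  by (simp only: smooth_on_open_iff) (intro allI, drule_tac x = "Suc k" in spec, simp)

lemma smooth_on_partial: "open S \<Longrightarrow> smooth_on S f \<Longrightarrow> smooth_on S (partial k f)"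
  unfolding partial_def[abs_def] by (rule smooth_on_frechet_derivative)

text \<open>\<^const>\<open>frechet_derivative\<close> is a choice operator; to show \<open>C\<^bsup>k+1\<^esup>\<close> it is enough to exhibit some
  derivative that is \<open>C\<^sup>k\<close>. The product and quotient rules then drive inductions on \<open>k\<close>.\<close>

lemma cont_diff_on_SucI:
  assumes "open S" "\<And>x. x \<in> S \<Longrightarrow> (f has_derivative f' x) (at x)"
    "\<And>v. cont_diff_on k S (\<lambda>x. f' x v)"
  shows "cont_diff_on (Suc k) S f"
proof -
  have "cont_diff_on k S (\<lambda>x. frechet_derivative f (at x) v)" for v
    by (rule cont_diff_on_cong[OF assms(1) _ assms(3)[of v]])
       (metis assms(2) frechet_derivative_at)
  then show ?thesis using assms(2) by (auto simp: differentiable_def)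
qed

lemma cont_diff_on_SucD:
  "cont_diff_on (Suc k) S f \<Longrightarrow> x \<in> S \<Longrightarrow>
     (f has_derivative frechet_derivative f (at x)) (at x)"
  by (simp add: frechet_derivative_works)

lemma cont_diff_on_const:
  assumes "open S" shows "cont_diff_on k S (\<lambda>x. a)"
  by (induction k arbitrary: a) (auto simp: frechet_derivative_const)

lemma cont_diff_on_bounded_linear:
  assumes "open S" "bounded_linear L" "cont_diff_on k S f"
  shows "cont_diff_on k S (\<lambda>x. L (f x))"
  using assms(3)
proof (induction k arbitrary: f)
  case 0
  then show ?case
    by (simp add: bounded_linear.continuous_on[OF assms(2)])
next
  case (Suc k)
  show ?case
  proof (rule cont_diff_on_SucI[OF assms(1)])
    show "((\<lambda>x. L (f x)) has_derivative (\<lambda>v. L (frechet_derivative f (at x) v))) (at x)"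
      if "x \<in> S" for x
      by (rule bounded_linear.has_derivative[OF assms(2) cont_diff_on_SucD[OF Suc.prems that]])
    show "cont_diff_on k S (\<lambda>x. L (frechet_derivative f (at x) v))" for v
      using Suc.prems by (intro Suc.IH) simp
  qed
qed

lemma cont_diff_on_add:
  assumes "open S" "cont_diff_on k S f" "cont_diff_on k S g"
  shows "cont_diff_on k S (\<lambda>x. f x + g x)"
  using assms(2,3)
proof (induction k arbitrary: f g)
  case 0
  then show ?case by (auto intro: continuous_intros)
next
  case (Suc k)
  show ?case
  proof (rule cont_diff_on_SucI[OF assms(1)])
    show "((\<lambda>x. f x + g x) has_derivative
        (\<lambda>v. frechet_derivative f (at x) v + frechet_derivative g (at x) v)) (at x)"
      if "x \<in> S" for x
      using Suc.prems that by (intro has_derivative_add cont_diff_on_SucD)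
    show "cont_diff_on k S (\<lambda>x. frechet_derivative f (at x) v + frechet_derivative g (at x) v)" for v
      using Suc.prems by (intro Suc.IH) simp_all
  qed
qed

lemma cont_diff_on_mult:
  fixes f g :: "'a::euclidean_space \<Rightarrow> real"
  assumes "open S" "cont_diff_on k S f" "cont_diff_on k S g"
  shows "cont_diff_on k S (\<lambda>x. f x * g x)"
  using assms(2,3)
proof (induction k arbitrary: f g)
  case 0
  then show ?case by (auto intro: continuous_intros)
next
  case (Suc k)
  show ?case
  proof (rule cont_diff_on_SucI[OF assms(1)])
    show "((\<lambda>x. f x * g x) has_derivative
        (\<lambda>v. f x * frechet_derivative g (at x) v + frechet_derivative f (at x) v * g x)) (at x)"
      if "x \<in> S" for x
      using Suc.prems that by (intro has_derivative_mult cont_diff_on_SucD)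
    show "cont_diff_on k S (\<lambda>x. f x * frechet_derivative g (at x) v +
        frechet_derivative f (at x) v * g x)" for v
      using Suc.prems Suc.prems[THEN cont_diff_on_Suc_imp]
      by (intro cont_diff_on_add[OF assms(1)] Suc.IH) simp_all
  qed
qed

lemma cont_diff_on_inverse:
  fixes f :: "'a::euclidean_space \<Rightarrow> real"
  assumes "open S" "\<And>x. x \<in> S \<Longrightarrow> f x \<noteq> 0" "cont_diff_on k S f"
  shows "cont_diff_on k S (\<lambda>x. inverse (f x))"
  using assms(3)
proof (induction k)
  case 0
  then show ?case using assms(2) by (simp add: continuous_on_inverse)
next
  case (Suc k)
  show ?case
  proof (rule cont_diff_on_SucI[OF assms(1)])
    show "((\<lambda>x. inverse (f x)) has_derivative
        (\<lambda>v. - (inverse (f x) * frechet_derivative f (at x) v * inverse (f x)))) (at x)"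
      if "x \<in> S" for x
      by (rule Deriv.has_derivative_inverse[OF assms(2)[OF that] cont_diff_on_SucD[OF Suc.prems that]])
    have "cont_diff_on k S (\<lambda>x. (-1) *
        (inverse (f x) * frechet_derivative f (at x) v * inverse (f x)))" for v
      using Suc.prems cont_diff_on_Suc_imp[OF Suc.prems]
      by (intro cont_diff_on_mult[OF assms(1)] Suc.IH cont_diff_on_const[OF assms(1)]) simp_all
    then show "cont_diff_on k S (\<lambda>x. - (inverse (f x) * frechet_derivative f (at x) v *
        inverse (f x)))" for v by simp
  qed
qed

lemma smooth_on_const: "open S \<Longrightarrow> smooth_on S (\<lambda>x. a)"
  by (simp add: smooth_on_open_iff cont_diff_on_const)

lemma smooth_on_bounded_linear:
  "open S \<Longrightarrow> bounded_linear L \<Longrightarrow> smooth_on S f \<Longrightarrow> smooth_on S (\<lambda>x. L (f x))"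
  by (simp add: smooth_on_open_iff cont_diff_on_bounded_linear)

lemma smooth_on_add:
  "open S \<Longrightarrow> smooth_on S f \<Longrightarrow> smooth_on S g \<Longrightarrow> smooth_on S (\<lambda>x. f x + g x)"
  by (simp add: smooth_on_open_iff cont_diff_on_add)

lemma smooth_on_mult:
  fixes f g :: "'a::euclidean_space \<Rightarrow> real"
  shows "open S \<Longrightarrow> smooth_on S f \<Longrightarrow> smooth_on S g \<Longrightarrow> smooth_on S (\<lambda>x. f x * g x)"
  by (simp add: smooth_on_open_iff cont_diff_on_mult)

lemma smooth_on_inverse:
  fixes f :: "'a::euclidean_space \<Rightarrow> real"
  shows "open S \<Longrightarrow> smooth_on S f \<Longrightarrow> (\<And>x. x \<in> S \<Longrightarrow> f x \<noteq> 0) \<Longrightarrow> smooth_on S (\<lambda>x. inverse (f x))"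
  by (simp add: smooth_on_open_iff cont_diff_on_inverse)

lemma smooth_on_diff:
  fixes f g :: "'a::euclidean_space \<Rightarrow> real"
  assumes "open S" "smooth_on S f" "smooth_on S g"
  shows "smooth_on S (\<lambda>x. f x - g x)"
  using smooth_on_add[OF assms(1,2) smooth_on_mult[OF assms(1) smooth_on_const[of S "-1"] assms(3)]]
    assms(1) by simp

lemma smooth_on_sum:
  assumes "open S" "\<And>i. i \<in> I \<Longrightarrow> smooth_on S (f i)"
  shows "smooth_on S (\<lambda>x. \<Sum>i\<in>I. f i x)"
  using assms(2)
  by (induction I rule: infinite_finite_induct)
     (auto intro: smooth_on_const smooth_on_add assms(1))

lemma smooth_on_prod:
  fixes f :: "'i \<Rightarrow> 'a::euclidean_space \<Rightarrow> real"
  assumes "open S" "\<And>i. i \<in> I \<Longrightarrow> smooth_on S (f i)"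
  shows "smooth_on S (\<lambda>x. \<Prod>i\<in>I. f i x)"
  using assms(2)
  by (induction I rule: infinite_finite_induct)
     (auto intro: smooth_on_const smooth_on_mult assms(1))

lemmas smooth_on_intros = smooth_on_const smooth_on_add smooth_on_diff smooth_on_mult smooth_on_sum

lemma smooth_on_component:
  "open S \<Longrightarrow> smooth_on S G \<Longrightarrow> smooth_on S (\<lambda>u. G u $ i $ j)"
  using smooth_on_bounded_linear[of S "\<lambda>A. A $ i $ j" G]
  by (simp add: bounded_linear_compose[OF bounded_linear_vec_nth bounded_linear_vec_nth])

lemma smooth_on_det:
  fixes M :: "'a::euclidean_space \<Rightarrow> real^'n^'n"
  assumes "open S" "\<And>i j. smooth_on S (\<lambda>u. M u $ i $ j)"
  shows "smooth_on S (\<lambda>u. det (M u))"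
  unfolding det_def by (intro smooth_on_intros smooth_on_prod assms)

lemma matrix_inv_inverse:
  fixes M :: "real^'n^'n"
  assumes "det M \<noteq> 0"
  shows "M ** matrix_inv M = mat 1" "matrix_inv M ** M = mat 1"
proof -
  have "invertible M" using assms by (simp add: invertible_det_nz)
  from someI_ex[OF this[unfolded invertible_def]]
  show "M ** matrix_inv M = mat 1" "matrix_inv M ** M = mat 1"
    by (simp_all add: matrix_inv_def)
qed

text \<open>By Cramer's rule each entry of the inverse is a quotient of determinants, hence of polynomials in
  the entries.\<close>

lemma smooth_on_matrix_inv:
  fixes M :: "'a::euclidean_space \<Rightarrow> real^'n^'n"
  assumes "open S" "\<And>i j. smooth_on S (\<lambda>u. M u $ i $ j)" "\<And>u. u \<in> S \<Longrightarrow> det (M u) \<noteq> 0"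
  shows "smooth_on S (\<lambda>u. matrix_inv (M u) $ i $ j)"
proof -
  define P where "P u = (\<chi> k l. if l = i then (axis j 1 :: real^'n) $ k else M u $ k $ l)" for u
  have "smooth_on S (\<lambda>u. P u $ k $ l)" for k l
    by (cases "l = i") (simp_all add: P_def assms smooth_on_const)
  then have "smooth_on S (\<lambda>u. det (P u) * inverse (det (M u)))"
    by (intro smooth_on_mult smooth_on_inverse smooth_on_det assms)
  moreover have "det (P u) * inverse (det (M u)) = matrix_inv (M u) $ i $ j" if "u \<in> S" for u
  proof -
    have "M u *v (matrix_inv (M u) *v axis j 1) = axis j 1"
      by (simp add: matrix_vector_mul_assoc matrix_inv_inverse assms(3) that)
    then have "matrix_inv (M u) *v axis j 1 = (\<chi> k. det (\<chi> m l. if l = k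
        then (axis j 1 :: real^'n) $ m else M u $ m $ l) / det (M u))"
      using cramer[OF assms(3)[OF that]] by blast
    then have "(matrix_inv (M u) *v axis j 1) $ i = det (P u) / det (M u)"
      by (simp add: P_def)
    then show ?thesis
      by (simp add: matrix_vector_mult_basis column_def divide_inverse)
  qed
  ultimately show ?thesis by (rule smooth_on_cong)
qed

section \<open>Adapted frames and coframes\<close>

lemma sum_UNIV_Plus:
  fixes f :: "'a::finite + 'b::finite \<Rightarrow> 'c::comm_monoid_add"
  shows "(\<Sum>\<alpha>\<in>UNIV. f \<alpha>) = (\<Sum>i\<in>UNIV. f (Inl i)) + (\<Sum>a\<in>UNIV. f (Inr a))"
  by (simp add: sum.Plus comp_def flip: UNIV_Plus_UNIV)

lemma sum_mult_delta [simp]: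
  fixes f :: "'a::finite \<Rightarrow> real"
  shows "(\<Sum>k\<in>UNIV. f k * (if k = a then 1 else 0)) = f a"
    and "(\<Sum>k\<in>UNIV. f k * (if a = k then 1 else 0)) = f a"
proof -
  have "f k * (if k = a then 1 else 0) = (if k = a then f k else 0)" for k by simp
  then show "(\<Sum>k\<in>UNIV. f k * (if k = a then 1 else 0)) = f a"
    by (simp only: sum.delta finite UNIV_I if_True)
  then show "(\<Sum>k\<in>UNIV. f k * (if a = k then 1 else 0)) = f a"
    by (simp only: eq_commute[of a])
qed

lemma h_frame_nth [simp]:
  "h_frame N i $ Inl j = (if j = i then 1 else 0)"
  "h_frame N i $ Inr a = - N $ i $ a"
  by (simp_all add: h_frame_def axis_def if_distrib sum.delta cong: if_cong)

lemma v_frame_nth [simp]: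
  "v_frame a $ Inl j = 0"
  "v_frame a $ Inr b = (if b = a then 1 else 0)"
  by (simp_all add: v_frame_def axis_def)

lemma coframe_frame [simp]:
  "h_coframe i (h_frame N j) = (if i = j then 1 else 0)"
  "h_coframe i (v_frame b) = 0"
  "v_coframe N a (h_frame N j) = 0"
  "v_coframe N a (v_frame b) = (if a = b then 1 else 0)"
  by (simp_all add: h_coframe_def v_coframe_def if_distrib sum.delta cong: if_cong)

lemma linear_h_coframe: "linear (h_coframe i)"
  by (rule linearI) (simp_all add: h_coframe_def)

lemma linear_v_coframe: "linear (v_coframe N a)"
  by (rule linearI) (simp_all add: v_coframe_def algebra_simps sum.distrib sum_distrib_left)

lemma frame_expansion:
  "X = (\<Sum>i\<in>UNIV. h_coframe i X *\<^sub>R h_frame N i) + (\<Sum>a\<in>UNIV. v_coframe N a X *\<^sub>R v_frame a)"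
proof -
  have "X $ \<alpha> = ((\<Sum>i\<in>UNIV. h_coframe i X *\<^sub>R h_frame N i) +
      (\<Sum>a\<in>UNIV. v_coframe N a X *\<^sub>R v_frame a)) $ \<alpha>" for \<alpha>
    by (cases \<alpha>) (simp_all add: if_distrib sum.delta' sum.delta v_coframe_def h_coframe_def
      sum_negf mult.commute cong: if_cong)
  then show ?thesis by (simp add: vec_eq_iff)
qed

lemma coframe_combination:
  "h_coframe k ((\<Sum>i\<in>UNIV. f i *\<^sub>R h_frame N i) + (\<Sum>a\<in>UNIV. f' a *\<^sub>R v_frame a)) = f k"
  "v_coframe N k ((\<Sum>i\<in>UNIV. f i *\<^sub>R h_frame N i) + (\<Sum>a\<in>UNIV. f' a *\<^sub>R v_frame a)) = f' k"
  by (simp_all add: linear_add[OF linear_h_coframe] linear_sum[OF linear_h_coframe]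
    linear_scale[OF linear_h_coframe] linear_add[OF linear_v_coframe]
    linear_sum[OF linear_v_coframe] linear_scale[OF linear_v_coframe])

lemma span_frame: "span (range (h_frame N) \<union> range v_frame) = UNIV"
proof -
  have "X \<in> span (range (h_frame N) \<union> range v_frame)" for X
    by (subst frame_expansion[of X N]) (intro span_add span_sum span_scale span_base; blast)
  then show ?thesis by blast
qed

lemma h_space_iff: "X \<in> h_space N \<longleftrightarrow> (\<forall>a. v_coframe N a X = 0)"
proof
  assume "X \<in> h_space N"
  then show "\<forall>a. v_coframe N a X = 0"
    unfolding h_space_def
    by (induction rule: span_induct_alt)
       (auto simp: linear_0[OF linear_v_coframe] linear_add[OF linear_v_coframe]
         linear_scale[OF linear_v_coframe])
next
  assume "\<forall>a. v_coframe N a X = 0"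
  then have "X = (\<Sum>i\<in>UNIV. h_coframe i X *\<^sub>R h_frame N i)"
    using frame_expansion[of X N] by simp
  moreover have "(\<Sum>i\<in>UNIV. h_coframe i X *\<^sub>R h_frame N i) \<in> h_space N"
    unfolding h_space_def by (intro span_sum span_scale span_base) blast
  ultimately show "X \<in> h_space N" by simp
qed

lemma v_space_iff: "X \<in> v_space \<longleftrightarrow> (\<forall>i. h_coframe i X = 0)"
proof
  assume "X \<in> v_space"
  then show "\<forall>i. h_coframe i X = 0"
    unfolding v_space_def
    by (induction rule: span_induct_alt)
       (auto simp: linear_0[OF linear_h_coframe] linear_add[OF linear_h_coframe]
         linear_scale[OF linear_h_coframe])
next
  assume "\<forall>i. h_coframe i X = 0"
  then have "X = (\<Sum>a\<in>UNIV. v_coframe 0 a X *\<^sub>R v_frame a)"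
    using frame_expansion[of X 0] by simp
  moreover have "(\<Sum>a\<in>UNIV. v_coframe 0 a X *\<^sub>R v_frame a) \<in> v_space"
    unfolding v_space_def by (intro span_sum span_scale span_base) blast
  ultimately show "X \<in> v_space" by simp
qed

section \<open>The connection with given adapted coefficients\<close>

definition connection_form ::
    "(real^('n::finite + 'n) \<Rightarrow> real^'n^'n) \<Rightarrow> (real^('n + 'n) \<Rightarrow> 'n \<Rightarrow> 'n \<Rightarrow> 'n \<Rightarrow> real) \<Rightarrow>
    (real^('n + 'n) \<Rightarrow> 'n \<Rightarrow> 'n \<Rightarrow> 'n \<Rightarrow> real) \<Rightarrow> real^('n + 'n) \<Rightarrow> 'n \<Rightarrow> 'n \<Rightarrow>
    real^('n + 'n) \<Rightarrow> real" where
  "connection_form N L C u i j X =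
     (\<Sum>k\<in>UNIV. L u i j k * h_coframe k X + C u i j k * v_coframe (N u) k X)"

text \<open>The connection form acts in the same way on the h- and on the v-components of \<open>Y\<close>. The last
  summand is due to the frame: the coordinate derivative of \<open>e\<^sub>j = \<partial>\<^sub>j - N\<^sub>j\<^sup>a \<partial>\<^sub>a\<close> along \<open>X\<close> is
  \<open>- X(N\<^sub>j\<^sup>a) \<partial>\<^sub>a\<close>, which has to cancel for the covariant derivative of \<open>e\<^sub>j\<close> to be horizontal.\<close>

definition adapted_term ::
    "(real^('n::finite + 'n) \<Rightarrow> real^'n^'n) \<Rightarrow> (real^('n + 'n) \<Rightarrow> 'n \<Rightarrow> 'n \<Rightarrow> 'n \<Rightarrow> real) \<Rightarrow>
    (real^('n + 'n) \<Rightarrow> 'n \<Rightarrow> 'n \<Rightarrow> 'n \<Rightarrow> real) \<Rightarrow> real^('n + 'n) \<Rightarrow>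
    real^('n + 'n) \<Rightarrow> real^('n + 'n) \<Rightarrow> real^('n + 'n)" where
  "adapted_term N L C u X Y =
     (\<Sum>i\<in>UNIV. (\<Sum>j\<in>UNIV. connection_form N L C u i j X * h_coframe j Y) *\<^sub>R h_frame (N u) i) +
     (\<Sum>a\<in>UNIV. (\<Sum>j\<in>UNIV. connection_form N L C u a j X * v_coframe (N u) j Y +
        frechet_derivative (\<lambda>w. N w $ j $ a) (at u) X * h_coframe j Y) *\<^sub>R v_frame a)"

definition adapted_connection ::
    "(real^('n::finite + 'n) \<Rightarrow> real^'n^'n) \<Rightarrow> (real^('n + 'n) \<Rightarrow> 'n \<Rightarrow> 'n \<Rightarrow> 'n \<Rightarrow> real) \<Rightarrow>
    (real^('n + 'n) \<Rightarrow> 'n \<Rightarrow> 'n \<Rightarrow> 'n \<Rightarrow> real) \<Rightarrow> ('n + 'n) connection" where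
  "adapted_connection N L C u \<gamma> \<beta> \<alpha> = adapted_term N L C u (axis \<alpha> 1) (axis \<beta> 1) $ \<gamma>"

lemma linear_connection_form: "linear (connection_form N L C u i j)"
  by (rule linearI) (simp_all add: connection_form_def linear_add[OF linear_h_coframe]
    linear_scale[OF linear_h_coframe] linear_add[OF linear_v_coframe]
    linear_scale[OF linear_v_coframe] algebra_simps sum.distrib sum_distrib_left)

lemma bilinear_adapted_term:
  assumes "\<And>j a. (\<lambda>w. N w $ j $ a) differentiable (at u)"
  shows "bilinear (adapted_term N L C u)"
  unfolding bilinear_def
proof (intro conjI allI)
  have D: "linear (frechet_derivative (\<lambda>w. N w $ j $ a) (at u))" for j a
    by (rule linear_frechet_derivative[OF assms])
  show "linear (\<lambda>X. adapted_term N L C u X Y)" for Y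
    by (rule linearI) (simp_all add: adapted_term_def linear_add[OF linear_connection_form]
      linear_scale[OF linear_connection_form] linear_add[OF D] linear_scale[OF D]
      algebra_simps sum.distrib scaleR_sum_right sum_distrib_left)
  show "linear (\<lambda>Y. adapted_term N L C u X Y)" for X
    by (rule linearI) (simp_all add: adapted_term_def
      linear_add[OF linear_h_coframe] linear_scale[OF linear_h_coframe]
      linear_add[OF linear_v_coframe] linear_scale[OF linear_v_coframe]
      algebra_simps sum.distrib scaleR_sum_right sum_distrib_left)
qed

lemma bilinear_connection_term: "bilinear (connection_term \<Gamma> u)"
  unfolding bilinear_def
  by (intro conjI allI linearI)
    (simp_all add: connection_term_def vec_eq_iff algebra_simps sum.distrib sum_distrib_left)

lemma connection_term_axis: "connection_term \<Gamma> u (axis \<alpha> 1) (axis \<beta> 1) $ \<gamma> = \<Gamma> u \<gamma> \<beta> \<alpha>"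
  by (simp add: connection_term_def axis_def)

lemma connection_term_eq_iff:
  assumes "\<And>j a. (\<lambda>w. N w $ j $ a) differentiable (at u)"
  shows "connection_term \<Gamma> u = adapted_term N L C u \<longleftrightarrow> \<Gamma> u = adapted_connection N L C u"
proof
  assume "connection_term \<Gamma> u = adapted_term N L C u"
  then show "\<Gamma> u = adapted_connection N L C u"
    by (simp add: fun_eq_iff adapted_connection_def flip: connection_term_axis[of \<Gamma>])
next
  assume E: "\<Gamma> u = adapted_connection N L C u"
  have "connection_term \<Gamma> u X Y = adapted_term N L C u X Y" for X Y
  proof (rule bilinear_eq_stdbasis[OF bilinear_connection_term bilinear_adapted_term[OF assms],
      THEN fun_cong, THEN fun_cong])
    show "connection_term \<Gamma> u i j = adapted_term N L C u i j" if "i \<in> Basis" "j \<in> Basis" for i j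
    proof -
      from that obtain \<alpha> \<beta> where "i = axis \<alpha> 1" "j = axis \<beta> 1"
        by (auto simp: Basis_vec_def)
      then show ?thesis
        by (subst vec_eq_iff) (simp add: connection_term_axis E adapted_connection_def)
    qed
  qed
  then show "connection_term \<Gamma> u = adapted_term N L C u" by (simp add: fun_eq_iff)
qed

lemma frechet_derivative_h_frame:
  assumes "\<And>j a. (\<lambda>w. N w $ j $ a) differentiable (at u)"
  shows "frechet_derivative (\<lambda>w. h_frame (N w) j) (at u) X =
    - (\<Sum>a\<in>UNIV. frechet_derivative (\<lambda>w. N w $ j $ a) (at u) X *\<^sub>R v_frame a)"
proof -
  have "((\<lambda>w. axis (Inl j) 1 - (\<Sum>a\<in>UNIV. N w $ j $ a *\<^sub>R axis (Inr a) 1)) has_derivative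
      (\<lambda>X. 0 - (\<Sum>a\<in>UNIV. frechet_derivative (\<lambda>w. N w $ j $ a) (at u) X *\<^sub>R axis (Inr a) 1))) (at u)"
    by (intro has_derivative_diff has_derivative_const has_derivative_sum
      has_derivative_scaleR_left iffD1[OF frechet_derivative_works] assms)
  from fun_cong[OF frechet_derivative_at[OF this, symmetric], of X] show ?thesis
    by (simp add: h_frame_def[abs_def] v_frame_def)
qed

text \<open>Both sides say that the bilinear maps \<^const>\<open>connection_term\<close> and \<^const>\<open>adapted_term\<close> agree: the
  conditions on the left prescribe the former on all pairs of frame vectors, and these span.\<close>

lemma adapted_coeffs_at_iff:
  assumes "\<And>j a. (\<lambda>w. N w $ j $ a) differentiable (at u)"
  shows "(\<forall>j k.
     covariant_derivative \<Gamma> (\<lambda>w. h_frame (N w) k) (\<lambda>w. h_frame (N w) j) u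
       = (\<Sum>i\<in>UNIV. L u i j k *\<^sub>R h_frame (N u) i) \<and>
     covariant_derivative \<Gamma> (\<lambda>w. h_frame (N w) k) (\<lambda>w. v_frame j) u
       = (\<Sum>i\<in>UNIV. L u i j k *\<^sub>R v_frame i) \<and>
     covariant_derivative \<Gamma> (\<lambda>w. v_frame k) (\<lambda>w. h_frame (N w) j) u
       = (\<Sum>i\<in>UNIV. C u i j k *\<^sub>R h_frame (N u) i) \<and>
     covariant_derivative \<Gamma> (\<lambda>w. v_frame k) (\<lambda>w. v_frame j) u
       = (\<Sum>i\<in>UNIV. C u i j k *\<^sub>R v_frame i)) \<longleftrightarrow> \<Gamma> u = adapted_connection N L C u"
    (is "?P \<longleftrightarrow> _")
proof -
  let ?T = "connection_term \<Gamma> u" and ?S = "adapted_term N L C u"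
  let ?B = "range (h_frame (N u)) \<union> range v_frame"
  have form: "connection_form N L C u i j (h_frame (N u) k) = L u i j k"
      "connection_form N L C u i j (v_frame k) = C u i j k" for i j k
    by (simp_all add: connection_form_def)
  have S: "?S (h_frame (N u) k) (h_frame (N u) j) = (\<Sum>i\<in>UNIV. L u i j k *\<^sub>R h_frame (N u) i) +
        (\<Sum>a\<in>UNIV. frechet_derivative (\<lambda>w. N w $ j $ a) (at u) (h_frame (N u) k) *\<^sub>R v_frame a)"
      "?S (h_frame (N u) k) (v_frame j) = (\<Sum>i\<in>UNIV. L u i j k *\<^sub>R v_frame i)"
      "?S (v_frame k) (h_frame (N u) j) = (\<Sum>i\<in>UNIV. C u i j k *\<^sub>R h_frame (N u) i) +
        (\<Sum>a\<in>UNIV. frechet_derivative (\<lambda>w. N w $ j $ a) (at u) (v_frame k) *\<^sub>R v_frame a)"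
      "?S (v_frame k) (v_frame j) = (\<Sum>i\<in>UNIV. C u i j k *\<^sub>R v_frame i)" for j k
    by (simp_all add: adapted_term_def form sum.distrib scaleR_add_left)
  have cov_h: "covariant_derivative \<Gamma> X (\<lambda>w. h_frame (N w) j) u = Z \<longleftrightarrow> ?T (X u) (h_frame (N u) j) =
        Z + (\<Sum>a\<in>UNIV. frechet_derivative (\<lambda>w. N w $ j $ a) (at u) (X u) *\<^sub>R v_frame a)" for X j Z
    by (simp add: covariant_derivative_def frechet_derivative_h_frame[OF assms] algebra_simps)
  have cov_v: "covariant_derivative \<Gamma> X (\<lambda>w. v_frame j) u = Z \<longleftrightarrow> ?T (X u) (v_frame j) = Z" for X j Z
    by (simp add: covariant_derivative_def frechet_derivative_const)
  have "?P \<longleftrightarrow> (\<forall>j k. ?T (h_frame (N u) k) (h_frame (N u) j) = ?S (h_frame (N u) k) (h_frame (N u) j) \<and>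
      ?T (h_frame (N u) k) (v_frame j) = ?S (h_frame (N u) k) (v_frame j) \<and>
      ?T (v_frame k) (h_frame (N u) j) = ?S (v_frame k) (h_frame (N u) j) \<and>
      ?T (v_frame k) (v_frame j) = ?S (v_frame k) (v_frame j))"
    by (simp only: cov_h cov_v S)
  also have "\<dots> \<longleftrightarrow> (\<forall>X\<in>?B. \<forall>Y\<in>?B. ?T X Y = ?S X Y)"
    by (simp only: ball_Un ball_simps simp_thms) (intro iffI allI conjI; simp)
  also have "\<dots> \<longleftrightarrow> ?T = ?S"
  proof
    assume "\<forall>X\<in>?B. \<forall>Y\<in>?B. ?T X Y = ?S X Y"
    then have "?T X Y = ?S X Y" for X Y
      by - (rule bilinear_eq[OF bilinear_connection_term bilinear_adapted_term[OF assms],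
          of UNIV ?B UNIV ?B], simp_all add: span_frame)
    then show "?T = ?S" by (simp add: fun_eq_iff)
  qed simp
  also have "\<dots> \<longleftrightarrow> \<Gamma> u = adapted_connection N L C u"
    by (rule connection_term_eq_iff[OF assms])
  finally show ?thesis .
qed

section \<open>Preservation of the splitting under parallel transport\<close>

text \<open>Gronwall: if \<open>K\<close> bounds the sum of the \<open>\<bar>M\<^sub>i\<^sub>j\<bar>\<close>, the energy \<open>E = \<Sum> W\<^sub>i\<^sup>2\<close> satisfies \<open>E' \<le> 2 K E\<close>, so
  \<open>exp (- 2 K t) E(t)\<close> is nonincreasing; it is nonnegative and starts at 0.\<close>

lemma linear_ode_zero:
  fixes W :: "real \<Rightarrow> 'n::finite \<Rightarrow> real"
  assumes W: "\<And>i t. t \<in> {0..1} \<Longrightarrow>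
      ((\<lambda>t. W t i) has_real_derivative (\<Sum>j\<in>UNIV. M t i j * W t j)) (at t within {0..1})"
    and M: "\<And>i j. continuous_on {0..1} (\<lambda>t. M t i j)"
    and W0: "\<And>i. W 0 i = 0"
  shows "W 1 i = 0"
proof -
  define E where "E t = (\<Sum>i\<in>UNIV. (W t i)\<^sup>2)" for t
  have "compact ((\<lambda>t. \<Sum>i\<in>UNIV. \<Sum>j\<in>UNIV. \<bar>M t i j\<bar>) ` {0..1})"
    by (intro compact_continuous_image continuous_intros M) simp
  then obtain K where K: "\<And>t. t \<in> {0..1} \<Longrightarrow> (\<Sum>i\<in>UNIV. \<Sum>j\<in>UNIV. \<bar>M t i j\<bar>) \<le> K"
    using bounded_imp_bdd_above[OF compact_imp_bounded] unfolding bdd_above_def by fastforce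
  define E' where "E' t = (\<Sum>i\<in>UNIV. \<Sum>j\<in>UNIV. 2 * W t i * (M t i j * W t j))" for t
  have dE: "(E has_real_derivative E' t) (at t within {0..1})" if "t \<in> {0..1}" for t
    unfolding E_def[abs_def] E'_def
    by (rule DERIV_sum, rule derivative_eq_intros, rule W[OF that])
      (simp add: sum_distrib_left algebra_simps)
  have E': "E' t \<le> 2 * K * E t" if "t \<in> {0..1}" for t
  proof -
    have E0: "0 \<le> E t" unfolding E_def by (intro sum_nonneg) simp
    have WW: "\<bar>W t i * W t j\<bar> \<le> E t" for i j
    proof -
      have "(W t i)\<^sup>2 \<le> E t" "(W t j)\<^sup>2 \<le> E t"
        unfolding E_def by (rule member_le_sum; simp)+
      moreover have "2 * \<bar>W t i * W t j\<bar> \<le> (W t i)\<^sup>2 + (W t j)\<^sup>2"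
        using sum_squares_bound[of "\<bar>W t i\<bar>" "\<bar>W t j\<bar>"] by (simp add: abs_mult)
      ultimately show ?thesis by simp
    qed
    have "2 * W t i * (M t i j * W t j) \<le> 2 * (\<bar>M t i j\<bar> * E t)" for i j
    proof -
      have "W t i * (M t i j * W t j) \<le> \<bar>M t i j * (W t i * W t j)\<bar>"
        by (simp add: abs_le_D1 algebra_simps)
      also have "\<dots> \<le> \<bar>M t i j\<bar> * E t"
        using mult_left_mono[OF WW, of "\<bar>M t i j\<bar>"] by (simp add: abs_mult)
      finally show ?thesis by simp
    qed
    then have "E' t \<le> (\<Sum>i\<in>UNIV. \<Sum>j\<in>UNIV. 2 * (\<bar>M t i j\<bar> * E t))"
      unfolding E'_def by (intro sum_mono)
    also have "\<dots> = 2 * (\<Sum>i\<in>UNIV. \<Sum>j\<in>UNIV. \<bar>M t i j\<bar>) * E t"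
      by (simp add: sum_distrib_left sum_distrib_right mult.assoc)
    also have "\<dots> \<le> 2 * K * E t"
      using K[OF that] E0 by (intro mult_right_mono) auto
    finally show ?thesis .
  qed
  define h where "h t = exp (- (2 * K * t)) * E t" for t
  have dh: "(h has_real_derivative exp (- (2 * K * t)) * (E' t - 2 * K * E t)) (at t within {0..1})"
    if "t \<in> {0..1}" for t
    unfolding h_def[abs_def]
    by (rule derivative_eq_intros dE[OF that] refl)+ (simp add: algebra_simps)
  have "h 1 \<le> h 0"
  proof (rule DERIV_nonpos_imp_decreasing_open[of 0 1 h])
    show "\<exists>y. (h has_real_derivative y) (at t) \<and> y \<le> 0" if "0 < t" "t < 1" for t
    proof (intro exI conjI)
      show "(h has_real_derivative exp (- (2 * K * t)) * (E' t - 2 * K * E t)) (at t)"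
        using dh[of t] that by (simp add: at_within_Icc_at)
      show "exp (- (2 * K * t)) * (E' t - 2 * K * E t) \<le> 0"
        using E'[of t] that by (simp add: mult_le_0_iff)
    qed
    show "continuous_on {0..1} h"
      by (rule DERIV_continuous_on[OF dh])
  qed simp
  moreover have "h 0 = 0" by (simp add: h_def E_def W0)
  ultimately have "E 1 \<le> 0" by (simp add: h_def mult_le_0_iff)
  moreover have "(W 1 i)\<^sup>2 \<le> E 1" unfolding E_def by (rule member_le_sum; simp)
  ultimately show ?thesis by (meson order_trans power2_less_eq_zero_iff)
qed

lemma smooth_on_connection_form:
  assumes "open U" "\<And>i a. smooth_on U (\<lambda>u. N u $ i $ a)"
    "\<And>i j k. smooth_on U (\<lambda>u. L u i j k)" "\<And>i j k. smooth_on U (\<lambda>u. C u i j k)"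
  shows "smooth_on U (\<lambda>u. connection_form N L C u i j X)"
  unfolding connection_form_def h_coframe_def v_coframe_def by (intro smooth_on_intros assms)

lemma smooth_on_adapted_connection:
  assumes "open U" "\<And>i a. smooth_on U (\<lambda>u. N u $ i $ a)"
    "\<And>i j k. smooth_on U (\<lambda>u. L u i j k)" "\<And>i j k. smooth_on U (\<lambda>u. C u i j k)"
  shows "smooth_on U (\<lambda>u. adapted_connection N L C u \<gamma> \<beta> \<alpha>)"
proof -
  have frame: "smooth_on U (\<lambda>u. h_frame (N u) i $ \<gamma>)" for i
  proof (cases \<gamma>)
    case (Inl j)
    then show ?thesis by (simp add: smooth_on_const assms(1))
  next
    case (Inr a)
    then show ?thesis
      using smooth_on_diff[OF assms(1) smooth_on_const[OF assms(1), of 0] assms(2)] by simp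
  qed
  show ?thesis
    unfolding adapted_connection_def adapted_term_def vector_add_component sum_component
      vector_scaleR_component real_scaleR_def
    by (intro smooth_on_intros frame smooth_on_connection_form smooth_on_frechet_derivative
        smooth_on_const assms)
       (unfold v_coframe_def h_coframe_def, intro smooth_on_intros assms)+
qed

text \<open>Let \<open>V\<close> be parallel along \<open>\<gamma>\<close>. The h-components of \<open>V\<close> solve \<open>W' = - \<omega>(\<gamma>') W\<close>. So do its
  v-components \<open>V\<^sup>a + N\<^sub>i\<^sup>a V\<^sup>i\<close>: the term from differentiating \<open>N\<^sub>i\<^sup>a\<close> along \<open>\<gamma>\<close> cancels the
  inhomogeneous summand of \<^const>\<open>adapted_term\<close>. If one of these families vanishes at time 0, it
  vanishes at time 1.\<close>

lemma d_connection_adapted: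
  assumes U: "open U"
    and N: "\<And>i a. smooth_on U (\<lambda>u. N u $ i $ a)"
    and L: "\<And>i j k. smooth_on U (\<lambda>u. L u i j k)" and C: "\<And>i j k. smooth_on U (\<lambda>u. C u i j k)"
    and \<Gamma>: "\<And>u. u \<in> U \<Longrightarrow> \<Gamma> u = adapted_connection N L C u"
  shows "d_connection U N \<Gamma>"
  unfolding d_connection_def
proof (intro conjI allI impI)
  show "smooth_on U (\<lambda>u. \<Gamma> u \<gamma> \<beta> \<alpha>)" for \<gamma> \<beta> \<alpha>
    by (rule smooth_on_cong[OF smooth_on_adapted_connection[OF U N L C]]) (simp add: \<Gamma>)
next
  fix \<gamma> \<gamma>' V
  assume A: "\<gamma> ` {0..1} \<subseteq> U \<and> continuous_on {0..1} \<gamma>' \<and>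
    (\<forall>t\<in>{0..1}. (\<gamma> has_vector_derivative \<gamma>' t) (at t within {0..1})) \<and> parallel_along \<Gamma> \<gamma> \<gamma>' V"
  then have \<gamma>U: "\<gamma> t \<in> U" if "t \<in> {0..1}" for t using that by blast
  from A have d\<gamma>: "(\<gamma> has_vector_derivative \<gamma>' t) (at t within {0..1})" if "t \<in> {0..1}" for t
    using that by blast
  have cont_\<gamma>: "continuous_on {0..1} \<gamma>"
    using d\<gamma> by (meson has_vector_derivative_continuous continuous_on_eq_continuous_within)
  have cont: "continuous_on {0..1} (\<lambda>t. f (\<gamma> t))" if "smooth_on U f" for f :: "_ \<Rightarrow> real"
    by (rule continuous_on_compose2[OF smooth_on_imp_continuous_on[OF U that] cont_\<gamma>]) (use \<gamma>U in auto)
  have cont_\<gamma>': "continuous_on {0..1} (\<lambda>t. \<gamma>' t $ \<alpha>)" for \<alpha>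
    using A by (intro continuous_intros) auto
  have Nd: "(\<lambda>w. N w $ j $ a) differentiable (at u)" if "u \<in> U" for u j a
    by (rule smooth_on_imp_differentiable[OF U N that])
  define Z where "Z t = adapted_term N L C (\<gamma> t) (\<gamma>' t) (V t)" for t
  have dV: "((\<lambda>t. V t $ \<alpha>) has_real_derivative - Z t $ \<alpha>) (at t within {0..1})"
    if "t \<in> {0..1}" for t \<alpha>
  proof -
    have "connection_term \<Gamma> (\<gamma> t) = adapted_term N L C (\<gamma> t)"
      using connection_term_eq_iff[OF Nd[OF \<gamma>U[OF that]]] \<Gamma>[OF \<gamma>U[OF that]] by blast
    then have "(V has_vector_derivative - Z t) (at t within {0..1})"
      using A that unfolding parallel_along_def Z_def by metis
    from bounded_linear.has_vector_derivative[OF bounded_linear_vec_nth this, of \<alpha>]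
    show ?thesis by (simp add: has_real_derivative_iff_has_vector_derivative)
  qed
  define M where "M t i j = - connection_form N L C (\<gamma> t) i j (\<gamma>' t)" for t i j
  have contM: "continuous_on {0..1} (\<lambda>t. M t i j)" for i j
    unfolding M_def connection_form_def h_coframe_def v_coframe_def
    by (intro continuous_intros cont cont_\<gamma>' N L C)
  have hZ: "h_coframe i (Z t) = (\<Sum>j\<in>UNIV. connection_form N L C (\<gamma> t) i j (\<gamma>' t) * h_coframe j (V t))"
    for i t unfolding Z_def adapted_term_def coframe_combination ..
  have vZ: "v_coframe (N (\<gamma> t)) a (Z t) =
      (\<Sum>j\<in>UNIV. connection_form N L C (\<gamma> t) a j (\<gamma>' t) * v_coframe (N (\<gamma> t)) j (V t) +
         frechet_derivative (\<lambda>w. N w $ j $ a) (at (\<gamma> t)) (\<gamma>' t) * h_coframe j (V t))"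
    for a t unfolding Z_def adapted_term_def coframe_combination ..
  show "V 1 \<in> v_space" if "V 0 \<in> v_space"
    unfolding v_space_iff
  proof
    fix i
    show "h_coframe i (V 1) = 0"
    proof (rule linear_ode_zero[of "\<lambda>t i. h_coframe i (V t)" M])
      show "((\<lambda>t. h_coframe i (V t)) has_real_derivative (\<Sum>j\<in>UNIV. M t i j * h_coframe j (V t)))
          (at t within {0..1})" if "t \<in> {0..1}" for i t
      proof -
        have "(\<Sum>j\<in>UNIV. M t i j * h_coframe j (V t)) = - Z t $ Inl i"
          using hZ[of i t] by (simp add: M_def h_coframe_def sum_negf)
        then show ?thesis using dV[OF that, of "Inl i"] by (simp add: h_coframe_def)
      qed
    qed (use that contM in \<open>auto simp: v_space_iff\<close>)
  qed
  show "V 1 \<in> h_space (N (\<gamma> 1))" if "V 0 \<in> h_space (N (\<gamma> 0))"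
    unfolding h_space_iff
  proof
    fix a
    show "v_coframe (N (\<gamma> 1)) a (V 1) = 0"
    proof (rule linear_ode_zero[of "\<lambda>t a. v_coframe (N (\<gamma> t)) a (V t)" M])
      show "((\<lambda>t. v_coframe (N (\<gamma> t)) a (V t)) has_real_derivative
          (\<Sum>j\<in>UNIV. M t a j * v_coframe (N (\<gamma> t)) j (V t))) (at t within {0..1})"
        if "t \<in> {0..1}" for a t
      proof -
        let ?dN = "\<lambda>i. frechet_derivative (\<lambda>w. N w $ i $ a) (at (\<gamma> t)) (\<gamma>' t)"
        have dN: "((\<lambda>t. N (\<gamma> t) $ i $ a) has_real_derivative ?dN i) (at t within {0..1})" for i
        proof -
          have "((\<lambda>w. N w $ i $ a) has_derivative frechet_derivative (\<lambda>w. N w $ i $ a) (at (\<gamma> t)))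
              (at (\<gamma> t) within \<gamma> ` {0..1})"
            using Nd[OF \<gamma>U[OF that]] frechet_derivative_works has_derivative_at_withinI by blast
          from vector_derivative_diff_chain_within[OF d\<gamma>[OF that] this]
          show ?thesis by (simp add: has_real_derivative_iff_has_vector_derivative comp_def)
        qed
        have "((\<lambda>t. v_coframe (N (\<gamma> t)) a (V t)) has_real_derivative
            - Z t $ Inr a + (\<Sum>i\<in>UNIV. ?dN i * V t $ Inl i + - Z t $ Inl i * N (\<gamma> t) $ i $ a))
            (at t within {0..1})"
          unfolding v_coframe_def by (intro DERIV_add DERIV_sum DERIV_mult dN dV[OF that])
        \<comment> \<open>The derivatives of \<open>N\<close> along the curve cancel against those in \<open>Z\<close>.\<close>
        moreover have "- Z t $ Inr a + (\<Sum>i\<in>UNIV. ?dN i * V t $ Inl i + - Z t $ Inl i * N (\<gamma> t) $ i $ a)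
            = (\<Sum>i\<in>UNIV. ?dN i * h_coframe i (V t)) - v_coframe (N (\<gamma> t)) a (Z t)"
          by (simp add: v_coframe_def h_coframe_def sum.distrib sum_negf algebra_simps sum_subtractf)
        moreover have "\<dots> = (\<Sum>j\<in>UNIV. M t a j * v_coframe (N (\<gamma> t)) j (V t))"
          unfolding vZ by (simp add: M_def sum.distrib sum_negf)
        ultimately show ?thesis by simp
      qed
    qed (use that contM in \<open>auto simp: h_space_iff\<close>)
  qed
qed

text \<open>Existence and uniqueness of the canonical d-connection of Cartan type: the explicit connection is
  the only candidate and it preserves the splitting.\<close>

lemma cartan_dconnection_iff:
  assumes U: "open U"
    and N: "\<And>i a. smooth_on U (\<lambda>u. N u $ i $ a)"
    and g: "\<And>i j. smooth_on U (\<lambda>u. g u $ i $ j)" "\<And>u. u \<in> U \<Longrightarrow> det (g u) \<noteq> 0"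
    and h: "\<And>i j. smooth_on U (\<lambda>u. h u $ i $ j)" "\<And>u. u \<in> U \<Longrightarrow> det (h u) \<noteq> 0"
  shows "cartan_dconnection U N g h \<Gamma> \<longleftrightarrow>
    (\<forall>u\<in>U. \<Gamma> u = adapted_connection N (L_coeff N g) (C_coeff h) u)"
proof -
  have L: "smooth_on U (\<lambda>u. L_coeff N g u i j k)" for i j k
    unfolding L_coeff_def h_partial_def
    by (intro smooth_on_intros smooth_on_matrix_inv smooth_on_partial U N g)
  have C: "smooth_on U (\<lambda>u. C_coeff h u i j k)" for i j k
    unfolding C_coeff_def
    by (intro smooth_on_intros smooth_on_matrix_inv smooth_on_partial U h)
  have Nd: "(\<lambda>w. N w $ j $ a) differentiable (at u)" if "u \<in> U" for u j a
    by (rule smooth_on_imp_differentiable[OF U N that])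
  have "has_adapted_coeffs U N (L_coeff N g) (C_coeff h) \<Gamma> \<longleftrightarrow>
      (\<forall>u\<in>U. \<Gamma> u = adapted_connection N (L_coeff N g) (C_coeff h) u)"
    unfolding has_adapted_coeffs_def by (rule ball_cong[OF refl adapted_coeffs_at_iff[OF Nd]])
  moreover have "d_connection U N \<Gamma>"
    if "\<forall>u\<in>U. \<Gamma> u = adapted_connection N (L_coeff N g) (C_coeff h) u"
    by (rule d_connection_adapted[where L = "L_coeff N g" and C = "C_coeff h", OF U N L C])
      (use that in blast)
  ultimately show ?thesis unfolding cartan_dconnection_def by blast
qed

lemma frechet_derivative_cong:
  assumes "open U" "u \<in> U" "\<And>w. w \<in> U \<Longrightarrow> f w = f' w"
  shows "frechet_derivative f (at u) = frechet_derivative f' (at u)"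
proof -
  have "(f has_derivative D) (at u) \<longleftrightarrow> (f' has_derivative D) (at u)" for D
    using assms
    by (auto elim: has_derivative_transform_within_open[of f D] has_derivative_transform_within_open[of f' D])
  then show ?thesis by (simp add: frechet_derivative_def)
qed

lemma partial_cong:
  assumes "open U" "u \<in> U" "\<And>w. w \<in> U \<Longrightarrow> f w = f' w"
  shows "partial k f u = partial k f' u"
  unfolding partial_def by (simp only: frechet_derivative_cong[OF assms])

text \<open>The connection depends on derivatives of the data, so agreement at a point is not enough; agreement
  on an open set is.\<close>

lemma adapted_connection_cong:
  assumes U: "open U" "u \<in> U"
    and eq: "\<And>w. w \<in> U \<Longrightarrow> N w = N' w" "\<And>w. w \<in> U \<Longrightarrow> g w = g' w" "\<And>w. w \<in> U \<Longrightarrow> h w = h' w"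
  shows "adapted_connection N (L_coeff N g) (C_coeff h) u =
    adapted_connection N' (L_coeff N' g') (C_coeff h') u"
proof -
  have g: "partial k (\<lambda>w. g w $ i $ j) u = partial k (\<lambda>w. g' w $ i $ j) u"
    and h: "partial k (\<lambda>w. h w $ i $ j) u = partial k (\<lambda>w. h' w $ i $ j) u" for i j k
    by (rule partial_cong[OF U], simp add: eq)+
  have N: "frechet_derivative (\<lambda>w. N w $ j $ a) (at u) = frechet_derivative (\<lambda>w. N' w $ j $ a) (at u)"
    for j a by (rule frechet_derivative_cong[OF U]) (simp add: eq)
  have "L_coeff N g u = L_coeff N' g' u" "C_coeff h u = C_coeff h' u"
    by (simp_all add: fun_eq_iff L_coeff_def C_coeff_def h_partial_def g h eq U)
  then show ?thesis
    by (simp add: fun_eq_iff adapted_connection_def adapted_term_def connection_form_def N eq U)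
qed

section \<open>The metric matrix of a Finsler function\<close>

lemma symmetric_nth: "transpose M = M \<Longrightarrow> M $ a $ b = M $ b $ a"
  by (metis transpose_def vec_lambda_beta)

text \<open>With \<open>n\<^sub>a(Z) = \<Sum>\<^sub>i N\<^sub>i\<^sup>a Z\<^sup>i\<close>, the v-part \<open>h\<^sub>a\<^sub>b (X\<^sup>a + n\<^sub>a(X)) (Y\<^sup>b + n\<^sub>b(Y))\<close> of the Sasaki type
  d-metric has four terms: the pure n-term is the correction in the hh-block of the matrix, the two
  mixed terms are the off-diagonal blocks (one of them after using symmetry of \<open>h\<close>).\<close>

lemma tensor_of_finsler_metric_matrix:
  fixes F :: "real^('n::finite + 'n) \<Rightarrow> real"
  assumes sym: "transpose (finsler_hessian F u) = finsler_hessian F u"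
  shows "tensor_of (finsler_metric_matrix F u) = sasaki_dmetric F u"
proof (intro ext)
  fix X Y
  define g where "g = finsler_hessian F u"
  define N where "N = canonical_nconnection F u"
  define n where "n a Z = (\<Sum>i\<in>UNIV. N $ i $ a * Z $ Inl i)" for a and Z :: "real^('n + 'n)"
  have g_sym: "g $ a $ b = g $ b $ a" for a b
    using symmetric_nth[OF sym] by (simp add: g_def)
  have hh: "(\<Sum>i\<in>UNIV. \<Sum>j\<in>UNIV. (\<Sum>a\<in>UNIV. \<Sum>b\<in>UNIV. N $ i $ a * N $ j $ b * g $ a $ b) * X $ Inl i * Y $ Inl j)
      = (\<Sum>a\<in>UNIV. \<Sum>b\<in>UNIV. g $ a $ b * n a X * n b Y)"
  proof -
    have "(\<Sum>a\<in>UNIV. \<Sum>b\<in>UNIV. g $ a $ b * n a X * n b Y)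
      = (\<Sum>a\<in>UNIV. \<Sum>b\<in>UNIV. \<Sum>i\<in>UNIV. \<Sum>j\<in>UNIV. N $ i $ a * N $ j $ b * g $ a $ b * X $ Inl i * Y $ Inl j)"
      by (simp add: n_def sum_distrib_left sum_distrib_right mult_ac)
    also have "\<dots> = (\<Sum>i\<in>UNIV. \<Sum>j\<in>UNIV. \<Sum>a\<in>UNIV. \<Sum>b\<in>UNIV. N $ i $ a * N $ j $ b * g $ a $ b * X $ Inl i * Y $ Inl j)"
      unfolding sum.cartesian_product
      by (rule sum.reindex_bij_witness[of _ "\<lambda>(i, j, a, b). (a, b, i, j)" "\<lambda>(a, b, i, j). (i, j, a, b)"]) auto
    finally show ?thesis by (simp add: sum_distrib_right)
  qed
  have hv: "(\<Sum>i\<in>UNIV. \<Sum>b\<in>UNIV. (\<Sum>e\<in>UNIV. N $ i $ e * g $ b $ e) * X $ Inl i * Y $ Inr b)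
      = (\<Sum>a\<in>UNIV. \<Sum>b\<in>UNIV. g $ a $ b * n a X * Y $ Inr b)"
  proof -
    have "(\<Sum>a\<in>UNIV. \<Sum>b\<in>UNIV. g $ a $ b * n a X * Y $ Inr b)
      = (\<Sum>a\<in>UNIV. \<Sum>b\<in>UNIV. \<Sum>i\<in>UNIV. N $ i $ a * g $ b $ a * X $ Inl i * Y $ Inr b)"
      by (simp add: n_def sum_distrib_left sum_distrib_right mult_ac g_sym)
    also have "\<dots> = (\<Sum>i\<in>UNIV. \<Sum>b\<in>UNIV. \<Sum>a\<in>UNIV. N $ i $ a * g $ b $ a * X $ Inl i * Y $ Inr b)"
      unfolding sum.cartesian_product
      by (rule sum.reindex_bij_witness[of _ "\<lambda>(i, b, a). (a, b, i)" "\<lambda>(a, b, i). (i, b, a)"]) auto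
    finally show ?thesis by (simp add: sum_distrib_right)
  qed
  have vh: "(\<Sum>a\<in>UNIV. \<Sum>j\<in>UNIV. (\<Sum>e\<in>UNIV. N $ j $ e * g $ a $ e) * X $ Inr a * Y $ Inl j)
      = (\<Sum>a\<in>UNIV. \<Sum>b\<in>UNIV. g $ a $ b * X $ Inr a * n b Y)"
  proof -
    have "(\<Sum>a\<in>UNIV. \<Sum>b\<in>UNIV. g $ a $ b * X $ Inr a * n b Y)
      = (\<Sum>a\<in>UNIV. \<Sum>b\<in>UNIV. \<Sum>j\<in>UNIV. N $ j $ b * g $ a $ b * X $ Inr a * Y $ Inl j)"
      by (simp add: n_def sum_distrib_left sum_distrib_right mult_ac)
    also have "\<dots> = (\<Sum>a\<in>UNIV. \<Sum>j\<in>UNIV. \<Sum>b\<in>UNIV. N $ j $ b * g $ a $ b * X $ Inr a * Y $ Inl j)"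
      by (intro sum.cong refl sum.swap)
    finally show ?thesis by (simp add: sum_distrib_right)
  qed
  have "tensor_of (finsler_metric_matrix F u) X Y =
      (\<Sum>i\<in>UNIV. \<Sum>j\<in>UNIV. g $ i $ j * X $ Inl i * Y $ Inl j) +
      (\<Sum>a\<in>UNIV. \<Sum>b\<in>UNIV. g $ a $ b * (X $ Inr a + n a X) * (Y $ Inr b + n b Y))"
    using hh hv vh
    by (simp add: tensor_of_def finsler_metric_matrix_def Let_def sum_UNIV_Plus g_def[symmetric]
      N_def[symmetric] distrib_left distrib_right sum.distrib)
  then show "tensor_of (finsler_metric_matrix F u) X Y = sasaki_dmetric F u X Y"
    by (simp add: sasaki_dmetric_def dmetric_def h_coframe_def v_coframe_def n_def g_def N_def)
qed

lemma v_block_finsler_metric_matrix: "v_block (finsler_metric_matrix F u) = finsler_hessian F u"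
  by (simp add: v_block_def finsler_metric_matrix_def Let_def vec_eq_iff)

text \<open>The off-diagonal block is \<open>N h\<close> for the canonical \<open>N\<close>, and \<open>h\<close> can be cancelled.\<close>

lemma determines_nconnection_finsler_metric_matrix:
  fixes F :: "real^('n::finite + 'n) \<Rightarrow> real"
  assumes sym: "transpose (finsler_hessian F u) = finsler_hessian F u"
    and det: "det (finsler_hessian F u) \<noteq> 0"
  shows "determines_nconnection (finsler_metric_matrix F u) N \<longleftrightarrow> N = canonical_nconnection F u"
proof -
  define g where "g = finsler_hessian F u"
  define N' where "N' = canonical_nconnection F u"
  have g_sym: "g $ a $ b = g $ b $ a" for a b
    using symmetric_nth[OF sym] by (simp add: g_def)
  have "determines_nconnection (finsler_metric_matrix F u) N \<longleftrightarrow> N' ** g = N ** g"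
    using det g_sym
    by (simp add: determines_nconnection_def v_block_finsler_metric_matrix vec_eq_iff
      matrix_matrix_mult_def) (simp add: finsler_metric_matrix_def Let_def g_def N'_def)
  also have "\<dots> \<longleftrightarrow> N = N'"
    using matrix_inv_inverse(1)[OF det] unfolding g_def
    by (metis matrix_mul_assoc matrix_mul_rid)
  finally show ?thesis by (simp add: N'_def)
qed

lemma h_block_finsler_metric_matrix:
  assumes "transpose (finsler_hessian F u) = finsler_hessian F u" "det (finsler_hessian F u) \<noteq> 0"
  shows "nconnection_of (finsler_metric_matrix F u) = canonical_nconnection F u"
    and "h_block (finsler_metric_matrix F u) = finsler_hessian F u"
proof -
  show N: "nconnection_of (finsler_metric_matrix F u) = canonical_nconnection F u"
    by (simp add: nconnection_of_def determines_nconnection_finsler_metric_matrix[OF assms])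
  show "h_block (finsler_metric_matrix F u) = finsler_hessian F u"
    by (simp add: h_block_def N tensor_of_finsler_metric_matrix[OF assms(1)] sasaki_dmetric_def
      dmetric_def vec_eq_iff)
qed

text \<open>This expresses \<open>N\<close> rationally through the entries of the metric matrix. It makes \<open>N\<close>
  smooth wherever the matrix is.\<close>

lemma canonical_nconnection_eq:
  fixes F :: "real^('n::finite + 'n) \<Rightarrow> real"
  assumes sym: "transpose (finsler_hessian F u) = finsler_hessian F u"
    and det: "det (finsler_hessian F u) \<noteq> 0"
  shows "canonical_nconnection F u $ i $ a = (\<Sum>b\<in>UNIV.
    finsler_metric_matrix F u $ Inl i $ Inr b * matrix_inv (finsler_hessian F u) $ b $ a)"
proof -
  define g where "g = finsler_hessian F u"
  define N where "N = canonical_nconnection F u"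
  have g_sym: "g $ a $ b = g $ b $ a" for a b
    using symmetric_nth[OF sym] by (simp add: g_def)
  have "N = (N ** g) ** matrix_inv g"
    using matrix_inv_inverse(1)[OF det] by (simp add: g_def flip: matrix_mul_assoc)
  then have "N $ i $ a = ((N ** g) ** matrix_inv g) $ i $ a" by simp
  also have "\<dots> = (\<Sum>b\<in>UNIV. (\<Sum>e\<in>UNIV. N $ i $ e * g $ b $ e) * matrix_inv g $ b $ a)"
    by (simp add: matrix_matrix_mult_def g_sym)
  finally show ?thesis by (simp add: finsler_metric_matrix_def Let_def g_def N_def)
qed

section \<open>Finsler structures along the flow\<close>

lemma open_slit_region:
  fixes c :: "('m, 'n::finite) chart"
  assumes "open (snd c ` fst c)"
  shows "open (slit_region c)"
proof -
  have c: "continuous_on UNIV xpart" "continuous_on UNIV ypart"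
    unfolding xpart_def[abs_def] ypart_def[abs_def] by (intro continuous_intros)+
  have "slit_region c = xpart -` (snd c ` fst c) \<inter> ypart -` (- {0})"
    by (auto simp: slit_region_def tm_region_def)
  then show ?thesis using open_vimage[OF assms c(1)] open_vimage[OF _ c(2), of "- {0}"] by auto
qed

text \<open>The triple (N-connection, h-metric, v-metric) extracted from \<open>G\<close> is \<open>(N, h, h)\<close> at every point of
  \<open>U\<close>, so both constructions yield the same connection, and \<open>D\<close> is that connection.\<close>

lemma dconnection_of_finsler_metric:
  fixes F :: "real^('n::finite + 'n) \<Rightarrow> real"
  assumes U: "open U"
    and G: "\<And>u. u \<in> U \<Longrightarrow> G u = finsler_metric_matrix F u"
    and smooth: "smooth_on U G"
    and sym: "\<And>u. u \<in> U \<Longrightarrow> transpose (finsler_hessian F u) = finsler_hessian F u"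
    and det: "\<And>u. u \<in> U \<Longrightarrow> det (finsler_hessian F u) \<noteq> 0"
  shows "\<exists>D. \<forall>D'. (canonical_dconnection U F D' \<longleftrightarrow> (\<forall>u\<in>U. D' u = D u)) \<and>
    (cartan_dconnection_of_metric U G D' \<longleftrightarrow> (\<forall>u\<in>U. D' u = D u))"
proof -
  let ?N = "canonical_nconnection F" and ?g = "finsler_hessian F"
  let ?N' = "nconnection_of \<circ> G" and ?g' = "h_block \<circ> G" and ?h' = "v_block \<circ> G"
  let ?D = "adapted_connection ?N (L_coeff ?N ?g) (C_coeff ?g)"
  have blocks: "?N u = ?N' u" "?g u = ?g' u" "?g u = ?h' u" if "u \<in> U" for u
    using that by (simp_all add: G h_block_finsler_metric_matrix v_block_finsler_metric_matrix sym det)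
  have g: "smooth_on U (\<lambda>u. ?g u $ i $ j)" for i j
    by (rule smooth_on_cong[OF smooth_on_component[OF U smooth, of "Inr i" "Inr j"]])
      (simp add: G finsler_metric_matrix_def Let_def)
  have N: "smooth_on U (\<lambda>u. ?N u $ i $ a)" for i a
  proof (rule smooth_on_cong)
    show "smooth_on U (\<lambda>u. \<Sum>b\<in>UNIV. G u $ Inl i $ Inr b * matrix_inv (?g u) $ b $ a)"
      by (intro smooth_on_intros smooth_on_component smooth_on_matrix_inv U smooth g det)
    show "(\<Sum>b\<in>UNIV. G u $ Inl i $ Inr b * matrix_inv (?g u) $ b $ a) = ?N u $ i $ a" if "u \<in> U" for u
      using that by (simp add: G canonical_nconnection_eq sym det)
  qed
  have "canonical_dconnection U F D' \<longleftrightarrow> (\<forall>u\<in>U. D' u = ?D u)" for D'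
    unfolding canonical_dconnection_def by (rule cartan_dconnection_iff[OF U N g det g det])
  moreover have "cartan_dconnection_of_metric U G D' \<longleftrightarrow> (\<forall>u\<in>U. D' u = ?D u)" for D'
  proof -
    have "cartan_dconnection_of_metric U G D' \<longleftrightarrow>
        (\<forall>u\<in>U. D' u = adapted_connection ?N' (L_coeff ?N' ?g') (C_coeff ?h') u)"
      unfolding cartan_dconnection_of_metric_def
    proof (rule cartan_dconnection_iff[OF U])
      show "smooth_on U (\<lambda>u. ?N' u $ i $ a)" for i a
        by (rule smooth_on_cong[OF N]) (simp only: blocks)
      show "smooth_on U (\<lambda>u. ?g' u $ i $ j)" for i j
        by (rule smooth_on_cong[OF g]) (simp only: blocks(2))
      show "smooth_on U (\<lambda>u. ?h' u $ i $ j)" for i j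
        by (rule smooth_on_cong[OF g]) (simp only: blocks(3))
    qed (simp_all only: blocks(2,3)[symmetric] det not_False_eq_True)
    also have "\<dots> \<longleftrightarrow> (\<forall>u\<in>U. D' u = ?D u)"
      by (rule ball_cong[OF refl]) (simp only: adapted_connection_cong[OF U _ blocks])
    finally show ?thesis .
  qed
  ultimately show ?thesis by blast
qed

theorem theorem5p2:
  fixes A :: "('m::{t2_space, second_countable_topology}, 'n::finite) chart set"
    and \<tau>\<^sub>0 :: real
    and F :: "real \<Rightarrow> ('m, 'n) tvec \<Rightarrow> real"
    and g :: "real \<Rightarrow> ('m, 'n) tm_metric"
    and g0 :: "('m, 'n) tm_metric"
    and r :: "real \<Rightarrow> real"
  assumes "smooth_atlas A"
    and "\<tau>\<^sub>0 > 0"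
    and "finsler_family A \<tau>\<^sub>0 F"
    and "\<forall>\<tau>\<in>{0..<\<tau>\<^sub>0}. \<forall>c\<in>A. \<forall>u\<in>slit_region c.
           g \<tau> c u = finsler_metric_matrix (local_rep A c (F \<tau>)) u"
    and "normalized_ricci_flow A \<tau>\<^sub>0 g g0 r"
  shows "\<forall>\<tau>\<in>{0..<\<tau>\<^sub>0}. \<forall>c\<in>A.
    (\<forall>u\<in>slit_region c.
       (\<forall>N. determines_nconnection (g \<tau> c u) N \<longleftrightarrow>
            N = canonical_nconnection (local_rep A c (F \<tau>)) u) \<and>
       tensor_of (g \<tau> c u) = sasaki_dmetric (local_rep A c (F \<tau>)) u) \<and>
    (\<exists>D. \<forall>D'.
       (canonical_dconnection (slit_region c) (local_rep A c (F \<tau>)) D' \<longleftrightarrow>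
          (\<forall>u\<in>slit_region c. D' u = D u)) \<and>
       (cartan_dconnection_of_metric (slit_region c) (g \<tau> c) D' \<longleftrightarrow>
          (\<forall>u\<in>slit_region c. D' u = D u)))"
proof (intro ballI)
  fix \<tau> c
  assume \<tau>: "\<tau> \<in> {0..<\<tau>\<^sub>0}" and c: "c \<in> A"
  let ?U = "slit_region c" and ?F = "local_rep A c (F \<tau>)"
  have U: "open ?U"
    using assms(1) c by (intro open_slit_region) (simp add: smooth_atlas_def)
  have G: "g \<tau> c u = finsler_metric_matrix ?F u" if "u \<in> ?U" for u
    using assms(4) \<tau> c that by blast
  have "metric_on_slit_bundle A (g \<tau>)"
    using assms(5) \<tau> unfolding normalized_ricci_flow_def by blast
  from conjunct1[OF this[unfolded metric_on_slit_bundle_def], rule_format, OF c]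
  have smooth: "smooth_on ?U (g \<tau> c)"
    and G_sym: "\<And>u. u \<in> ?U \<Longrightarrow> transpose (g \<tau> c u) = g \<tau> c u"
    by simp_all
  have det: "det (finsler_hessian ?F u) \<noteq> 0" if "u \<in> ?U" for u
    using assms(3) \<tau> c that unfolding finsler_family_def by blast
  \<comment> \<open>The Hessian is symmetric as a diagonal block of a symmetric matrix.\<close>
  have sym: "transpose (finsler_hessian ?F u) = finsler_hessian ?F u" if "u \<in> ?U" for u
    using G_sym[OF that]
    by (simp add: v_block_def transpose_def vec_eq_iff G[OF that] flip: v_block_finsler_metric_matrix)
  show "(\<forall>u\<in>?U. (\<forall>N. determines_nconnection (g \<tau> c u) N \<longleftrightarrow> N = canonical_nconnection ?F u) \<and>
       tensor_of (g \<tau> c u) = sasaki_dmetric ?F u) \<and>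
    (\<exists>D. \<forall>D'. (canonical_dconnection ?U ?F D' \<longleftrightarrow> (\<forall>u\<in>?U. D' u = D u)) \<and>
       (cartan_dconnection_of_metric ?U (g \<tau> c) D' \<longleftrightarrow> (\<forall>u\<in>?U. D' u = D u)))"
    using dconnection_of_finsler_metric[OF U G smooth sym det]
    by (simp add: G determines_nconnection_finsler_metric_matrix tensor_of_finsler_metric_matrix sym det)
qed

end
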